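(* Let $(\phi_t)$ be a parabolic semigroup of positive hyperbolic step in $\mathbb{D}$ which induces the semigroup of composition operators $(T_t)$ on the Dirichlet space $\mathcal{D}$. Let $\sigma_{\mathcal{D}}$ be the point spectrum of the infinitesimal generator of $(T_t)$. Then: (a) If $(\phi_t)$ is a group, then $\sigma_{\mathcal{D}}=\{0\}$. (b) If $(\phi_t)$ has a repelling fixed point, then $\sigma_{\mathcal{D}}=\{0\}$. (c) If $(\phi_t)$ is of finite shift, then $\sigma_{\mathcal{D}}=\{0\}$.
   Context: $\mathbb{D}$ is the open unit disk. A semigroup in $\mathbb{D}$ is a family $(\phi_t)_{t\ge0}$ of holomorphic maps $\phi_t:\mathbb{D}\to\mathbb{D}$ with $\phi_0=\mathrm{id}$, $\phi_{t+s}=\phi_t\circ\phi_s$ for all $t,s\ge0$, and $\phi_t(z)\to z$ uniformly on compacta as $t\to0^+$. It is a group if every $\phi_t$ is an automorphism of $\mathbb{D}$. It is non-elliptic if there is $\tau\in\partial\mathbb{D}$ (the Denjoy–Wolff point) with $\phi_t(z)\to\tau$ as $t\to+\infty$ for all $z\in\mathbb{D}$; a non-elliptic semigroup is parabolic if the angular derivative satisfies $\phi_1'(\tau)=1$. For a non-elliptic semigroup there is a univalent map $h:\mathbb{D}\to\mathbb{C}$, unique up to translation, the Koenigs function, with $h(\phi_t(z))=h(z)+t$ for all $t\ge0$, $z\in\mathbb{D}$; $\Omega:=h(\mathbb{D})$ is the Koenigs domain. A parabolic semigroup is of positive hyperbolic step if $\Omega$ is contained in a horizontal half-plane ($\{\mathrm{Im}\,w>c\}$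 or $\{\mathrm{Im}\,w<c\}$). A repelling fixed point of $(\phi_t)$ is a point $\sigma\in\partial\mathbb{D}$ such that, for all $t>0$, $\angle\lim_{z\to\sigma}\phi_t(z)=\sigma$ and the angular derivative $\phi_t'(\sigma)$ is finite and $>1$. A horodisk centered at $\tau$ is a disk contained in $\mathbb{D}$ internally tangent to $\partial\mathbb{D}$ at $\tau$. A non-elliptic semigroup is of finite shift if there is $z\in\mathbb{D}$ whose orbit $\{\phi_t(z):t\ge0\}$ does not intersect some horodisk centered at the Denjoy–Wolff point $\tau$. The Dirichlet space $\mathcal{D}$ is the space of holomorphic $f:\mathbb{D}\to\mathbb{C}$ with $\int_{\mathbb{D}}|f'(z)|^2\,dA(z)<+\infty$ ($dA$ normalized area measure), with its usual norm. $T_t(f)=f\circ\phi_t$, $f\in\mathcal{D}$, is a strongly continuous semigroup of bounded operators; its infinitesimal generator is $\Gamma_{\mathcal{D}}(f)=\lim_{t\to0^+}(T_t(f)-f)/t$ (norm limit), defined on those $f\in\mathcal{D}$ for which the limit exists in $\mathcal{D}$. The point spectrum is the set of eigenvalues $\lambda\in\mathbb{C}$ of $\Gamma_{\mathcal{D}}$. *)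

theory Defs
  imports "HOL-Complex_Analysis.Complex_Analysis"
begin

abbreviation unit_disk :: "complex set" where
  "unit_disk \<equiv> ball 0 1"

abbreviation unit_circle :: "complex set" where
  "unit_circle \<equiv> sphere 0 1"

section \<open>Angular limits and angular derivatives\<close>

definition stolz_region :: "complex \<Rightarrow> real \<Rightarrow> complex set" where
  "stolz_region \<sigma> R = {z \<in> unit_disk. cmod (\<sigma> - z) < R * (1 - cmod z)}"

definition has_angular_limit :: "(complex \<Rightarrow> complex) \<Rightarrow> complex \<Rightarrow> complex \<Rightarrow> bool" where
  "has_angular_limit f \<sigma> l \<longleftrightarrow> (\<forall>R>1. (f \<longlongrightarrow> l) (at \<sigma> within stolz_region \<sigma> R))"

text \<open>The boundary value in the difference quotient is the angular limit of \<open>f\<close> at \<open>\<sigma>\<close>;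
  the value \<open>f \<sigma>\<close> plays no role. Only finite angular derivatives are covered.\<close>

definition has_angular_derivative :: "(complex \<Rightarrow> complex) \<Rightarrow> complex \<Rightarrow> complex \<Rightarrow> bool" where
  "has_angular_derivative f \<sigma> d \<longleftrightarrow>
     (\<exists>\<omega>. has_angular_limit f \<sigma> \<omega> \<and> has_angular_limit (\<lambda>z. (f z - \<omega>) / (z - \<sigma>)) \<sigma> d)"

section \<open>Semigroups of holomorphic self-maps of the disk\<close>

text \<open>Families are indexed by all reals and maps are total on \<open>complex\<close>, but only times
  \<open>t \<ge> 0\<close> and points of the disk are ever constrained or used.\<close>

definition holomorphic_semigroup :: "(real \<Rightarrow> complex \<Rightarrow> complex) \<Rightarrow> bool" where
  "holomorphic_semigroup \<phi> \<longleftrightarrow>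
     (\<forall>t\<ge>0. \<phi> t holomorphic_on unit_disk \<and> \<phi> t ` unit_disk \<subseteq> unit_disk) \<and>
     (\<forall>z\<in>unit_disk. \<phi> 0 z = z) \<and>
     (\<forall>t\<ge>0. \<forall>s\<ge>0. \<forall>z\<in>unit_disk. \<phi> (t + s) z = \<phi> t (\<phi> s z)) \<and>
     (\<forall>K. compact K \<and> K \<subseteq> unit_disk \<longrightarrow> uniform_limit K \<phi> (\<lambda>z. z) (at_right 0))"

definition disk_automorphism :: "(complex \<Rightarrow> complex) \<Rightarrow> bool" where
  "disk_automorphism f \<longleftrightarrow>
     f holomorphic_on unit_disk \<and> bij_betw f unit_disk unit_disk \<and>
     inv_into unit_disk f holomorphic_on unit_disk"

definition is_group :: "(real \<Rightarrow> complex \<Rightarrow> complex) \<Rightarrow> bool" where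
  "is_group \<phi> \<longleftrightarrow> (\<forall>t\<ge>0. disk_automorphism (\<phi> t))"

definition denjoy_wolff_point :: "(real \<Rightarrow> complex \<Rightarrow> complex) \<Rightarrow> complex \<Rightarrow> bool" where
  "denjoy_wolff_point \<phi> \<tau> \<longleftrightarrow>
     \<tau> \<in> unit_circle \<and> (\<forall>z\<in>unit_disk. ((\<lambda>t. \<phi> t z) \<longlongrightarrow> \<tau>) at_top)"

definition non_elliptic_semigroup :: "(real \<Rightarrow> complex \<Rightarrow> complex) \<Rightarrow> bool" where
  "non_elliptic_semigroup \<phi> \<longleftrightarrow> holomorphic_semigroup \<phi> \<and> (\<exists>\<tau>. denjoy_wolff_point \<phi> \<tau>)"

definition parabolic_semigroup :: "(real \<Rightarrow> complex \<Rightarrow> complex) \<Rightarrow> bool" where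
  "parabolic_semigroup \<phi> \<longleftrightarrow> non_elliptic_semigroup \<phi> \<and>
     (\<exists>\<tau>. denjoy_wolff_point \<phi> \<tau> \<and> has_angular_derivative (\<phi> 1) \<tau> 1)"

definition koenigs_function :: "(real \<Rightarrow> complex \<Rightarrow> complex) \<Rightarrow> (complex \<Rightarrow> complex) \<Rightarrow> bool" where
  "koenigs_function \<phi> h \<longleftrightarrow>
     h holomorphic_on unit_disk \<and> inj_on h unit_disk \<and>
     (\<forall>t\<ge>0. \<forall>z\<in>unit_disk. h (\<phi> t z) = h z + of_real t)"

text \<open>The Koenigs function exists and is unique up to translation, and containment of its image
  in some horizontal half-plane is invariant under translation; so it does not matter which
  Koenigs function is taken.\<close>

definition positive_hyperbolic_step :: "(real \<Rightarrow> complex \<Rightarrow> complex) \<Rightarrow> bool" where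
  "positive_hyperbolic_step \<phi> \<longleftrightarrow>
     (\<exists>h c. koenigs_function \<phi> h \<and>
        (h ` unit_disk \<subseteq> {w. Im w > c} \<or> h ` unit_disk \<subseteq> {w. Im w < c}))"

definition repelling_fixed_point :: "(real \<Rightarrow> complex \<Rightarrow> complex) \<Rightarrow> complex \<Rightarrow> bool" where
  "repelling_fixed_point \<phi> \<sigma> \<longleftrightarrow> \<sigma> \<in> unit_circle \<and>
     (\<forall>t>0. has_angular_limit (\<phi> t) \<sigma> \<sigma> \<and>
        (\<exists>a::real. a > 1 \<and> has_angular_derivative (\<phi> t) \<sigma> (of_real a)))"

text \<open>The horodisk of Euclidean radius \<open>r\<close>, for \<open>0 < r < 1\<close> and \<open>\<tau>\<close> on the unit circle.\<close>

definition horodisk :: "complex \<Rightarrow> real \<Rightarrow> complex set" where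
  "horodisk \<tau> r = ball (of_real (1 - r) * \<tau>) r"

definition finite_shift :: "(real \<Rightarrow> complex \<Rightarrow> complex) \<Rightarrow> bool" where
  "finite_shift \<phi> \<longleftrightarrow>
     (\<exists>\<tau>. denjoy_wolff_point \<phi> \<tau> \<and>
        (\<exists>z\<in>unit_disk. \<exists>r. 0 < r \<and> r < 1 \<and> {\<phi> t z |t. t \<ge> 0} \<inter> horodisk \<tau> r = {}))"

section \<open>The Dirichlet space and the generator of the composition semigroup\<close>

text \<open>Elements of the Dirichlet space are represented by total functions, whose values outside
  the disk are irrelevant.\<close>

definition dirichlet_space :: "(complex \<Rightarrow> complex) set" where
  "dirichlet_space = {f. f holomorphic_on unit_disk \<and>
     set_integrable lborel unit_disk (\<lambda>z. (cmod (deriv f z))\<^sup>2)}"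

definition dirichlet_norm :: "(complex \<Rightarrow> complex) \<Rightarrow> real" where
  "dirichlet_norm f =
     sqrt ((cmod (f 0))\<^sup>2 + (1 / pi) * (LINT z:unit_disk|lborel. (cmod (deriv f z))\<^sup>2))"

text \<open>Membership in the space is required explicitly, since \<open>dirichlet_norm\<close> is meaningful
  only there.\<close>

definition dirichlet_tendsto ::
    "('a \<Rightarrow> complex \<Rightarrow> complex) \<Rightarrow> (complex \<Rightarrow> complex) \<Rightarrow> 'a filter \<Rightarrow> bool" where
  "dirichlet_tendsto F g A \<longleftrightarrow>
     g \<in> dirichlet_space \<and> (\<forall>\<^sub>F t in A. F t \<in> dirichlet_space) \<and>
     ((\<lambda>t. dirichlet_norm (\<lambda>z. F t z - g z)) \<longlongrightarrow> 0) A"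

definition composition_operator ::
    "(real \<Rightarrow> complex \<Rightarrow> complex) \<Rightarrow> real \<Rightarrow> (complex \<Rightarrow> complex) \<Rightarrow> complex \<Rightarrow> complex" where
  "composition_operator \<phi> t f = f \<circ> \<phi> t"

text \<open>The generator as a graph: \<open>f\<close> lies in its domain and \<open>g\<close> is its value at \<open>f\<close>.\<close>

definition dirichlet_generator ::
    "(real \<Rightarrow> complex \<Rightarrow> complex) \<Rightarrow> (complex \<Rightarrow> complex) \<Rightarrow> (complex \<Rightarrow> complex) \<Rightarrow> bool" where
  "dirichlet_generator \<phi> f g \<longleftrightarrow> f \<in> dirichlet_space \<and>
     dirichlet_tendsto (\<lambda>t z. (composition_operator \<phi> t f z - f z) / of_real t) g (at_right 0)"

definition dirichlet_point_spectrum :: "(real \<Rightarrow> complex \<Rightarrow> complex) \<Rightarrow> complex set" where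
  "dirichlet_point_spectrum \<phi> =
     {\<mu>. \<exists>f. (\<exists>z\<in>unit_disk. f z \<noteq> 0) \<and> dirichlet_generator \<phi> f (\<lambda>z. \<mu> * f z)}"

end

theory Submission
  imports Defs
begin

text \<open>Evaluation at a point of the disk is continuous for the Dirichlet norm, so an eigenfunction \<open>f\<close> of
  the generator with eigenvalue \<open>\<mu>\<close> has derivative \<open>\<mu> f\<close> along the flow; in the coordinate \<open>h\<close> the
  flow is translation, hence \<open>f = c exp (\<mu> h)\<close> (lemma \<open>eigenfunction_form\<close>). The constants give the
  eigenvalue \<open>0\<close>, and what has to be shown is that \<open>exp (\<mu> h)\<close> has infinite Dirichlet integral
  whenever \<open>\<mu> \<noteq> 0\<close>.

  The obstruction is the same in all cases. A function of finite Dirichlet integral satisfies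
  \<open>(1 - |z|) |f' z| \<rightarrow> 0\<close> as \<open>|z| \<rightarrow> 1\<close>, so its oscillation between points at bounded hyperbolic
  distance tends to \<open>0\<close> at the unit circle (\<open>dirichlet_pick_step\<close>). It therefore suffices to find a
  sequence that tends to the circle, has bounded hyperbolic steps, and along which \<open>exp (\<mu> h)\<close> keeps
  changing by a fixed amount; growth by a fixed factor \<open>> 1\<close> is enough.

  If \<open>Re \<mu> \<ge> 0\<close>, a forward orbit is such a sequence: its hyperbolic steps do not increase, by
  Schwarz-Pick, and \<open>f\<close> is multiplied by \<open>exp (\<mu> t) \<noteq> 1\<close> without decreasing in modulus. Let
  \<open>Re \<mu> < 0\<close>. For a group, a backward orbit serves in the same way.

  At a repelling fixed point \<open>\<sigma>\<close> with multiplier \<open>a\<close> the points \<open>z n = (1 - a^(-n)) \<sigma>\<close> replace a backward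
  orbit: \<open>\<phi> 1\<close> carries \<open>z (n + 1)\<close> to within \<open>o(1 - |z n|)\<close> of \<open>z n\<close>. Horodisks at the Denjoy-Wolff point
  \<open>\<tau>\<close> are invariant (\<open>Re_cayley_flow\<close>), which makes a suitable multiple of \<open>(\<tau> - z)^2 h' z\<close> a function of
  nonnegative real part and bounds \<open>h'\<close> by a multiple of \<open>1 / (1 - |z|)\<close> away from \<open>\<tau>\<close>. Consequently
  \<open>h (z (n + 1)) - h (z n) \<rightarrow> -1\<close>, and \<open>|f (z n)|\<close> grows geometrically.

  For finite shift, move \<open>\<tau>\<close> to infinity by the Cayley transform \<open>C\<close> of the disk onto the right half-plane
  and rotate the half-plane containing the image of \<open>h\<close> to the right half-plane as well; \<open>h\<close> becomes \<open>q\<close>.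
  The orbit of finite shift keeps \<open>Re C\<close> bounded, so by Schwarz-Pick \<open>C\<close> grows at most linearly along
  it, while \<open>q\<close> moves by \<open>\<plusminus>\<i>\<close> in each unit of time. Comparing \<open>q\<close> with \<open>C\<close> at these points yields
  \<open>Re q \<ge> \<kappa> Re C\<close> with \<open>\<kappa> > 0\<close>, that is, a positive angular derivative of \<open>q\<close> at infinity, and then
  \<open>q \<sim> \<kappa> C\<close> on every ray \<open>C z = s d\<close>, \<open>Re d > 0\<close>. The image of \<open>h\<close> thus reaches all directions of an open
  half-plane whose boundary is horizontal; as \<open>Re \<mu> \<noteq> 0\<close>, in one of these directions \<open>Re (\<mu> h)\<close> grows linearly,
  and \<open>f\<close> is too large there.\<close>

section \<open>An area estimate for holomorphic functions\<close>

lemma lborel_complex_eq_distr: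
  "(lborel :: complex measure) = distr (lborel :: (real \<times> real) measure) borel (\<lambda>(x, y). Complex x y)"
proof (rule lborel_eqI)
  have meas [measurable]: "(\<lambda>(x, y). Complex x y) \<in> borel_measurable (borel :: (real \<times> real) measure)"
    unfolding case_prod_beta
    by (intro borel_measurable_continuous_onI continuous_intros)
  fix l u :: complex
  assume lu: "\<And>b. b \<in> Basis \<Longrightarrow> l \<bullet> b \<le> u \<bullet> b"
  have vim: "(\<lambda>(x, y). Complex x y) -` box l u = box (Re l, Im l) (Re u, Im u)"
    by (auto simp: box_def Basis_complex_def Basis_prod_def)
  have le: "Re l \<le> Re u" "Im l \<le> Im u"
    using lu[of 1] lu[of \<i>] by (auto simp: Basis_complex_def)
  have "emeasure (distr (lborel :: (real \<times> real) measure) borel (\<lambda>(x, y). Complex x y)) (box l u)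
      = emeasure lborel (box (Re l, Im l) (Re u, Im u))"
    by (subst emeasure_distr) (auto simp: vim)
  also have "\<dots> = (\<Prod>b\<in>Basis. ((Re u, Im u) - (Re l, Im l)) \<bullet> b)"
    using le by (subst emeasure_lborel_box) (auto simp: Basis_prod_def)
  also have "\<dots> = (\<Prod>b\<in>Basis. (u - l) \<bullet> b)"
    by (simp add: Basis_prod_def Basis_complex_def mult.commute)
  finally show "emeasure (distr (lborel :: (real \<times> real) measure) borel (\<lambda>(x, y). Complex x y)) (box l u)
      = (\<Prod>b\<in>Basis. (u - l) \<bullet> b)" .
qed simp

lemma nn_integral_lborel_complex:
  assumes [measurable]: "g \<in> borel_measurable borel"
  shows "(\<integral>\<^sup>+z. g z \<partial>lborel) = (\<integral>\<^sup>+x. \<integral>\<^sup>+y. g (Complex x y) \<partial>lborel \<partial>lborel)"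
    and "(\<integral>\<^sup>+z. g z \<partial>lborel) = (\<integral>\<^sup>+y. \<integral>\<^sup>+x. g (Complex x y) \<partial>lborel \<partial>lborel)"
proof -
  have meas [measurable]: "(\<lambda>(x, y). Complex x y) \<in> borel_measurable (borel :: (real \<times> real) measure)"
    unfolding case_prod_beta
    by (intro borel_measurable_continuous_onI continuous_intros)
  have gm: "(\<lambda>p. g (case p of (x, y) \<Rightarrow> Complex x y)) \<in> borel_measurable (lborel \<Otimes>\<^sub>M lborel)"
    by (simp add: lborel_prod)
  have "(\<integral>\<^sup>+z. g z \<partial>lborel) = (\<integral>\<^sup>+p. g (case p of (x, y) \<Rightarrow> Complex x y) \<partial>(lborel \<Otimes>\<^sub>M lborel))"
    by (subst lborel_complex_eq_distr) (simp add: nn_integral_distr lborel_prod)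
  then show "(\<integral>\<^sup>+z. g z \<partial>lborel) = (\<integral>\<^sup>+x. \<integral>\<^sup>+y. g (Complex x y) \<partial>lborel \<partial>lborel)"
    and "(\<integral>\<^sup>+z. g z \<partial>lborel) = (\<integral>\<^sup>+y. \<integral>\<^sup>+x. g (Complex x y) \<partial>lborel \<partial>lborel)"
    using lborel.nn_integral_fst[OF gm] lborel_pair.nn_integral_snd[OF gm] by simp_all
qed

lemma norm_integral_le_nn_integral:
  fixes k :: "real \<Rightarrow> complex"
  assumes "continuous_on {a..b} k"
  shows "ennreal (cmod (integral {a..b} k)) \<le> (\<integral>\<^sup>+x. ennreal (cmod (k x)) * indicator {a..b} x \<partial>lborel)"
proof -
  have cn: "continuous_on {a..b} (\<lambda>x. cmod (k x))"
    by (intro continuous_intros assms)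
  have "cmod (integral {a..b} k) \<le> integral {a..b} (\<lambda>x. cmod (k x))"
    using assms cn by (intro integral_norm_bound_integral integrable_continuous_interval) auto
  moreover have "ennreal (integral {a..b} (\<lambda>x. cmod (k x)))
      = (\<integral>\<^sup>+x. ennreal (indicator {a..b} x *\<^sub>R cmod (k x)) \<partial>lborel)"
  proof (rule nn_integral_has_integral_lborel[symmetric])
    show "(\<lambda>x. indicator {a..b} x *\<^sub>R cmod (k x)) \<in> borel_measurable borel"
      using cn by (intro borel_measurable_continuous_on_indicator) auto
    have "((\<lambda>x. cmod (k x)) has_integral integral {a..b} (\<lambda>x. cmod (k x))) {a..b}"
      using cn by (intro integrable_integral integrable_continuous_interval)
    then show "((\<lambda>x. indicator {a..b} x *\<^sub>R cmod (k x)) has_integral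
        integral {a..b} (\<lambda>x. cmod (k x))) UNIV"
      by (subst (asm) has_integral_restrict_UNIV[symmetric])
        (simp add: indicator_def of_bool_def if_distrib[of "\<lambda>c. c * _"] cong: if_cong)
  qed auto
  moreover have "(\<integral>\<^sup>+x. ennreal (indicator {a..b} x *\<^sub>R cmod (k x)) \<partial>lborel)
      = (\<integral>\<^sup>+x. ennreal (cmod (k x)) * indicator {a..b} x \<partial>lborel)"
    by (intro nn_integral_cong) (auto simp: indicator_def)
  ultimately show ?thesis
    by (metis ennreal_leI)
qed

lemma contour_integral_horizontal:
  assumes "a < b"
  shows "contour_integral (linepath (Complex a y) (Complex b y)) f = integral {a..b} (\<lambda>x. f (Complex x y))"
proof -
  have "linepath (Complex a y) (Complex b y) x = Complex (Re (linepath (of_real a) (of_real b) x)) y" for x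
    by (simp add: linepath_def complex_eq_iff algebra_simps)
  then have "contour_integral (linepath (Complex a y) (Complex b y)) f
      = contour_integral (linepath (of_real a) (of_real b)) (\<lambda>z. f (Complex (Re z) y))"
    by (simp add: contour_integral_integral Complex_eq)
  then show ?thesis
    using assms by (simp add: contour_integral_linepath_Reals_eq)
qed

lemma norm_rectpath_integral_le:
  assumes ab: "a < b" "c < d" and cont: "continuous_on (cbox (Complex a c) (Complex b d) - box (Complex a c) (Complex b d)) g"
  shows "ennreal (cmod (contour_integral (rectpath (Complex a c) (Complex b d)) g)) \<le>
      (\<integral>\<^sup>+x. ennreal (cmod (g (Complex x c))) * indicator {a..b} x \<partial>lborel)
    + (\<integral>\<^sup>+y. ennreal (cmod (g (Complex b y))) * indicator {c..d} y \<partial>lborel)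
    + (\<integral>\<^sup>+x. ennreal (cmod (g (Complex x d))) * indicator {a..b} x \<partial>lborel)
    + (\<integral>\<^sup>+y. ennreal (cmod (g (Complex a y))) * indicator {c..d} y \<partial>lborel)"
proof -
  let ?l = "\<lambda>p q. contour_integral (linepath p q) g"
  let ?B = "cbox (Complex a c) (Complex b d) - box (Complex a c) (Complex b d)"
  have hor: "closed_segment (Complex a y) (Complex b y) = (\<lambda>x. Complex x y) ` {a..b}"
    and ver: "closed_segment (Complex x c) (Complex x d) = (\<lambda>y. Complex x y) ` {c..d}" for x y
    using ab by (auto simp: closed_segment_same_Im closed_segment_same_Re closed_segment_eq_real_ivl image_iff complex_eq_iff)
  have sub: "(\<lambda>x. Complex x y) ` {a..b} \<subseteq> ?B" if "y = c \<or> y = d" for y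
    using that ab by (auto simp: in_cbox_complex_iff in_box_complex_iff)
  have sub': "(\<lambda>y. Complex x y) ` {c..d} \<subseteq> ?B" if "x = a \<or> x = b" for x
    using that ab by (auto simp: in_cbox_complex_iff in_box_complex_iff)
  have int_h: "g contour_integrable_on linepath (Complex a y) (Complex b y)" if "y = c \<or> y = d" for y
    using sub[OF that] hor cont by (intro contour_integrable_continuous_linepath) (metis continuous_on_subset)
  have int_v: "g contour_integrable_on linepath (Complex x c) (Complex x d)" if "x = a \<or> x = b" for x
    using sub'[OF that] ver cont by (intro contour_integrable_continuous_linepath) (metis continuous_on_subset)
  have rev: "?l (Complex b d) (Complex a d) = - ?l (Complex a d) (Complex b d)"
      "?l (Complex a d) (Complex a c) = - ?l (Complex a c) (Complex a d)"
    using sub[of d] sub'[of a] hor[of d] ver[of a] cont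
    by (metis closed_segment_commute continuous_on_subset contour_integral_reverse_linepath)+
  have int_r: "g contour_integrable_on linepath (Complex b d) (Complex a d)"
      "g contour_integrable_on linepath (Complex a d) (Complex a c)"
    using int_h[of d] int_v[of a] by (metis contour_integrable_reversepath reversepath_linepath valid_path_linepath)+
  have eq: "contour_integral (rectpath (Complex a c) (Complex b d)) g
      = ?l (Complex a c) (Complex b c) + ?l (Complex b c) (Complex b d)
      - ?l (Complex a d) (Complex b d) - ?l (Complex a c) (Complex a d)"
    using int_h[of c] int_v[of b] int_r
    by (simp add: rectpath_def Let_def contour_integral_join valid_path_join rev)
  have h: "ennreal (cmod (?l (Complex a y) (Complex b y)))
      \<le> (\<integral>\<^sup>+x. ennreal (cmod (g (Complex x y))) * indicator {a..b} x \<partial>lborel)" if "y = c \<or> y = d" for y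
  proof -
    have "continuous_on {a..b} (\<lambda>x. g (Complex x y))"
      unfolding Complex_eq
      by (intro continuous_on_compose2[OF cont] continuous_intros) (use sub[OF that] in \<open>simp add: Complex_eq\<close>)
    moreover have "?l (Complex a y) (Complex b y) = integral {a..b} (\<lambda>x. g (Complex x y))"
      using ab(1) by (rule contour_integral_horizontal)
    ultimately show ?thesis
      using norm_integral_le_nn_integral by presburger
  qed
  have v: "ennreal (cmod (?l (Complex x c) (Complex x d)))
      \<le> (\<integral>\<^sup>+y. ennreal (cmod (g (Complex x y))) * indicator {c..d} y \<partial>lborel)" if "x = a \<or> x = b" for x
  proof -
    have "continuous_on {c..d} (\<lambda>y. g (Complex x y))"
      unfolding Complex_eq
      by (intro continuous_on_compose2[OF cont] continuous_intros) (use sub'[OF that] in \<open>simp add: Complex_eq\<close>)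
    moreover have "?l (Complex x c) (Complex x d) = \<i> * integral {c..d} (\<lambda>y. g (Complex x y))"
      using ab by (subst contour_integral_linepath_same_Re[where c=x and a=c and b=d]) (auto simp: complex_eq_iff)
    ultimately show ?thesis
      using norm_integral_le_nn_integral[of c d "\<lambda>y. g (Complex x y)"] by (simp add: norm_mult)
  qed
  have "cmod (contour_integral (rectpath (Complex a c) (Complex b d)) g)
      \<le> cmod (?l (Complex a c) (Complex b c)) + cmod (?l (Complex b c) (Complex b d))
      + cmod (?l (Complex a d) (Complex b d)) + cmod (?l (Complex a c) (Complex a d))"
    unfolding eq by norm
  then have "ennreal (cmod (contour_integral (rectpath (Complex a c) (Complex b d)) g))
      \<le> ennreal (cmod (?l (Complex a c) (Complex b c))) + ennreal (cmod (?l (Complex b c) (Complex b d)))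
      + ennreal (cmod (?l (Complex a d) (Complex b d))) + ennreal (cmod (?l (Complex a c) (Complex a d)))"
    by (simp add: ennreal_plus[symmetric] ennreal_leI del: ennreal_plus)
  also have "\<dots> \<le> (\<integral>\<^sup>+x. ennreal (cmod (g (Complex x c))) * indicator {a..b} x \<partial>lborel)
    + (\<integral>\<^sup>+y. ennreal (cmod (g (Complex b y))) * indicator {c..d} y \<partial>lborel)
    + (\<integral>\<^sup>+x. ennreal (cmod (g (Complex x d))) * indicator {a..b} x \<partial>lborel)
    + (\<integral>\<^sup>+y. ennreal (cmod (g (Complex a y))) * indicator {c..d} y \<partial>lborel)"
    by (intro add_mono h v) auto
  finally show ?thesis .
qed

text \<open>A mean value inequality, with a constant that makes no claim to be sharp. Cauchy's formula over the boundary of the square of half-side \<open>s\<close>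
  centred at \<open>u\<close> bounds \<open>|H u|\<close> by \<open>1 / (2 \<pi> s)\<close> times the integral of \<open>|H|\<close> over the four sides.
  Integrating over \<open>s\<close> between \<open>\<rho> / 4\<close> and \<open>\<rho> / 2\<close>, each side sweeps out a part of the disk, and
  Tonelli's theorem turns its contribution into an area integral. Squares are taken
  in place of circles so that the integration can be done in Cartesian coordinates.\<close>

lemma holomorphic_mean_bound:
  assumes hol: "H holomorphic_on ball u \<rho>" and \<rho>: "\<rho> > 0"
  shows "ennreal (pi * \<rho>\<^sup>2 / 32 * cmod (H u)) \<le> (\<integral>\<^sup>+z. ennreal (cmod (H z)) * indicator (ball u \<rho>) z \<partial>lborel)"
proof -
  define p q where "p = Re u" "q = Im u"
  define G where "G z = ennreal (cmod (H z)) * indicator (ball u \<rho>) z" for z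
  have [measurable]: "G \<in> borel_measurable borel"
  proof -
    have "(\<lambda>z. indicator (ball u \<rho>) z *\<^sub>R cmod (H z)) \<in> borel_measurable borel"
      using hol by (intro borel_measurable_continuous_on_indicator continuous_intros holomorphic_on_imp_continuous_on) auto
    then have "(\<lambda>z. ennreal (indicator (ball u \<rho>) z *\<^sub>R cmod (H z))) \<in> borel_measurable borel" by measurable
    also have "(\<lambda>z. ennreal (indicator (ball u \<rho>) z *\<^sub>R cmod (H z))) = G"
      by (auto simp: G_def indicator_def)
    finally show ?thesis .
  qed
  have Gm: "(\<lambda>(s, x). G (Complex x (t + k * s))) \<in> borel_measurable (lborel \<Otimes>\<^sub>M lborel)"
      "(\<lambda>(s, y). G (Complex (t + k * s) y)) \<in> borel_measurable (lborel \<Otimes>\<^sub>M lborel)" for t k :: real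
  proof -
    have "(\<lambda>z. Complex (snd z) (t + k * fst z)) \<in> borel_measurable (borel :: (real \<times> real) measure)"
      "(\<lambda>z. Complex (t + k * fst z) (snd z)) \<in> borel_measurable (borel :: (real \<times> real) measure)"
      by (intro borel_measurable_continuous_onI continuous_intros)+
    then show "(\<lambda>(s, x). G (Complex x (t + k * s))) \<in> borel_measurable (lborel \<Otimes>\<^sub>M lborel)"
      "(\<lambda>(s, y). G (Complex (t + k * s) y)) \<in> borel_measurable (lborel \<Otimes>\<^sub>M lborel)"
      unfolding lborel_prod case_prod_beta by measurable
  qed
  have Gm1: "(\<lambda>s. \<integral>\<^sup>+x. G (Complex x (t + k * s)) \<partial>lborel) \<in> borel_measurable lborel"
     "(\<lambda>s. \<integral>\<^sup>+y. G (Complex (t + k * s) y) \<partial>lborel) \<in> borel_measurable lborel" for t k :: real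
    using lborel.borel_measurable_nn_integral_fst[OF Gm(1)[of t k]]
      lborel.borel_measurable_nn_integral_fst[OF Gm(2)[of t k]] by simp_all
  let ?A = "\<integral>\<^sup>+z. G z \<partial>lborel"
  have shift: "(\<integral>\<^sup>+s. \<integral>\<^sup>+x. G (Complex x (t + k * s)) \<partial>lborel \<partial>lborel) = ?A"
    "(\<integral>\<^sup>+s. \<integral>\<^sup>+y. G (Complex (t + k * s) y) \<partial>lborel \<partial>lborel) = ?A" if "k = 1 \<or> k = -1" for t k :: real
  proof -
    have k: "k \<noteq> 0" "\<bar>k\<bar> = 1" using that by auto
    have m: "(\<lambda>s. \<integral>\<^sup>+x. G (Complex x s) \<partial>lborel) \<in> borel_measurable borel"
      "(\<lambda>s. \<integral>\<^sup>+x. G (Complex s x) \<partial>lborel) \<in> borel_measurable borel"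
      using Gm1[of 0 1] by simp_all
    show "(\<integral>\<^sup>+s. \<integral>\<^sup>+x. G (Complex x (t + k * s)) \<partial>lborel \<partial>lborel) = ?A"
      "(\<integral>\<^sup>+s. \<integral>\<^sup>+y. G (Complex (t + k * s) y) \<partial>lborel \<partial>lborel) = ?A"
      using nn_integral_real_affine[OF m(1) k(1), of t] nn_integral_real_affine[OF m(2) k(1), of t] k
        nn_integral_lborel_complex[of G] by simp_all
  qed
  have main: "ennreal (2 * pi * s * cmod (H u)) \<le>
      (\<integral>\<^sup>+x. G (Complex x (q + (-1) * s)) \<partial>lborel) + (\<integral>\<^sup>+y. G (Complex (p + 1 * s) y) \<partial>lborel)
    + (\<integral>\<^sup>+x. G (Complex x (q + 1 * s)) \<partial>lborel) + (\<integral>\<^sup>+y. G (Complex (p + (-1) * s) y) \<partial>lborel)"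
    if s: "0 < s" "s \<le> \<rho>/2" for s
  proof -
    let ?a1 = "Complex (p - s) (q - s)" and ?a3 = "Complex (p + s) (q + s)"
    have inb: "Complex x y \<in> ball u \<rho>" if "\<bar>x - p\<bar> \<le> s" "\<bar>y - q\<bar> \<le> s" for x y
    proof -
      have "(cmod (Complex x y - u))\<^sup>2 = \<bar>x - p\<bar>\<^sup>2 + \<bar>y - q\<bar>\<^sup>2"
        by (simp add: cmod_power2 p_q_def)
      also have "\<dots> \<le> s\<^sup>2 + s\<^sup>2" using that by (intro add_mono power_mono) auto
      also have "\<dots> \<le> (\<rho>/2)\<^sup>2 + (\<rho>/2)\<^sup>2" using s by (intro add_mono power_mono) auto
      also have "\<dots> < \<rho>\<^sup>2" using \<rho> by (simp add: power2_eq_square field_simps)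
      finally have "cmod (Complex x y - u) < \<rho>" using \<rho> power_less_imp_less_base[of _ 2 \<rho>] by auto
      then show ?thesis by (simp add: dist_norm norm_minus_commute)
    qed
    have cb: "cbox ?a1 ?a3 \<subseteq> ball u \<rho>"
    proof
      fix w assume "w \<in> cbox ?a1 ?a3"
      then show "w \<in> ball u \<rho>"
        using inb[of "Re w" "Im w"] by (simp add: in_cbox_complex_iff abs_le_iff)
    qed
    have uin: "u \<in> box ?a1 ?a3" using s by (simp add: in_box_complex_iff p_q_def)
    have pim: "path_image (rectpath ?a1 ?a3) = cbox ?a1 ?a3 - box ?a1 ?a3"
      using s by (intro path_image_rectpath_cbox_minus_box) auto
    have far: "s \<le> cmod (w - u)" if "w \<in> cbox ?a1 ?a3 - box ?a1 ?a3" for w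
    proof -
      have "\<bar>Re w - p\<bar> \<ge> s \<or> \<bar>Im w - q\<bar> \<ge> s"
        using that by (auto simp: in_box_complex_iff)
      then show ?thesis
        using abs_Re_le_cmod[of "w - u"] abs_Im_le_cmod[of "w - u"] by (auto simp: p_q_def)
    qed
    define g where "g w = H w / (w - u)" for w
    have "(g has_contour_integral 2*pi * \<i> * winding_number (rectpath ?a1 ?a3) u * H u) (rectpath ?a1 ?a3)"
      unfolding g_def using hol cb pim uin \<rho>
      by (intro Cauchy_integral_formula_convex_simple[where S="ball u \<rho>"]) auto
    then have ci: "contour_integral (rectpath ?a1 ?a3) g = 2*pi * \<i> * H u"
      using uin by (simp add: winding_number_rectpath contour_integral_unique)
    have gcont: "continuous_on (cbox ?a1 ?a3 - box ?a1 ?a3) g"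
      unfolding g_def using cb uin hol
      by (intro continuous_intros) (auto intro!: holomorphic_on_imp_continuous_on elim!: holomorphic_on_subset)
    have gG: "ennreal s * ennreal (cmod (g w)) \<le> G w" if "w \<in> cbox ?a1 ?a3 - box ?a1 ?a3" for w
    proof -
      have "s * cmod (g w) \<le> cmod (H w)"
        using mult_right_mono[OF far[OF that], of "cmod (H w)"] far[OF that] s
        by (auto simp: g_def norm_divide divide_simps mult_ac)
      then show ?thesis
        using that cb s by (auto simp: G_def ennreal_mult[symmetric] ennreal_leI subset_iff)
    qed
    have "ennreal (2 * pi * s * cmod (H u)) = ennreal s * ennreal (cmod (contour_integral (rectpath ?a1 ?a3) g))"
      using s by (simp add: ci norm_mult ennreal_mult[symmetric] mult_ac)
    also have "\<dots> \<le> ennreal s * ((\<integral>\<^sup>+x. ennreal (cmod (g (Complex x (q - s)))) * indicator {p - s..p + s} x \<partial>lborel)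
    + (\<integral>\<^sup>+y. ennreal (cmod (g (Complex (p + s) y))) * indicator {q - s..q + s} y \<partial>lborel)
    + (\<integral>\<^sup>+x. ennreal (cmod (g (Complex x (q + s)))) * indicator {p - s..p + s} x \<partial>lborel)
    + (\<integral>\<^sup>+y. ennreal (cmod (g (Complex (p - s) y))) * indicator {q - s..q + s} y \<partial>lborel))"
      using s gcont by (intro mult_left_mono norm_rectpath_integral_le) auto
    also have "\<dots> \<le> (\<integral>\<^sup>+x. G (Complex x (q - s)) \<partial>lborel) + (\<integral>\<^sup>+y. G (Complex (p + s) y) \<partial>lborel)
    + (\<integral>\<^sup>+x. G (Complex x (q + s)) \<partial>lborel) + (\<integral>\<^sup>+y. G (Complex (p - s) y) \<partial>lborel)"
    proof -
      have mon: "ennreal s * (\<integral>\<^sup>+x. ennreal (cmod (g (c x))) * indicator {a..b} x \<partial>lborel)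
          \<le> (\<integral>\<^sup>+x. G (c x) \<partial>lborel)"
        if "c ` {a..b} \<subseteq> cbox ?a1 ?a3 - box ?a1 ?a3" "continuous_on {a..b} c" for c :: "real \<Rightarrow> complex" and a b
      proof -
        have "continuous_on {a..b} (\<lambda>x. cmod (g (c x)))"
          using continuous_on_compose2[OF gcont that(2)] that(1) by (auto intro!: continuous_intros)
        then have "(\<lambda>x. indicator {a..b} x *\<^sub>R cmod (g (c x))) \<in> borel_measurable borel"
          by (intro borel_measurable_continuous_on_indicator) auto
        then have "(\<lambda>x. ennreal (indicator {a..b} x *\<^sub>R cmod (g (c x)))) \<in> borel_measurable lborel"
          by measurable
        also have "(\<lambda>x. ennreal (indicator {a..b} x *\<^sub>R cmod (g (c x))))
            = (\<lambda>x. ennreal (cmod (g (c x))) * indicator {a..b} x)" by (auto simp: indicator_def)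
        finally have "ennreal s * (\<integral>\<^sup>+x. ennreal (cmod (g (c x))) * indicator {a..b} x \<partial>lborel)
            = (\<integral>\<^sup>+x. ennreal s * (ennreal (cmod (g (c x))) * indicator {a..b} x) \<partial>lborel)"
          by (simp add: nn_integral_cmult)
        also have "\<dots> \<le> (\<integral>\<^sup>+x. G (c x) \<partial>lborel)"
          using gG that(1) by (intro nn_integral_mono) (auto simp: indicator_def image_subset_iff)
        finally show ?thesis .
      qed
      show ?thesis
        unfolding distrib_left using s
        by (intro add_mono mon) (auto simp: in_cbox_complex_iff in_box_complex_iff intro!: continuous_intros)
    qed
    finally show ?thesis by simp
  qed
  let ?I = "\<lambda>s. indicator {\<rho>/4..\<rho>/2} s :: ennreal"
  have "ennreal (pi * \<rho>\<^sup>2 / 8 * cmod (H u)) = (\<integral>\<^sup>+s. ennreal (pi * \<rho> / 2 * cmod (H u)) * ?I s \<partial>lborel)"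
    using \<rho> by (simp add: nn_integral_cmult_indicator ennreal_mult[symmetric] power2_eq_square field_simps)
  also have "\<dots> \<le> (\<integral>\<^sup>+s. (\<integral>\<^sup>+x. G (Complex x (q + (-1) * s)) \<partial>lborel) + (\<integral>\<^sup>+y. G (Complex (p + 1 * s) y) \<partial>lborel)
    + (\<integral>\<^sup>+x. G (Complex x (q + 1 * s)) \<partial>lborel) + (\<integral>\<^sup>+y. G (Complex (p + (-1) * s) y) \<partial>lborel) \<partial>lborel)"
  proof (intro nn_integral_mono)
    fix s :: real
    show "ennreal (pi * \<rho> / 2 * cmod (H u)) * ?I s \<le> (\<integral>\<^sup>+x. G (Complex x (q + (-1) * s)) \<partial>lborel) + (\<integral>\<^sup>+y. G (Complex (p + 1 * s) y) \<partial>lborel)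
    + (\<integral>\<^sup>+x. G (Complex x (q + 1 * s)) \<partial>lborel) + (\<integral>\<^sup>+y. G (Complex (p + (-1) * s) y) \<partial>lborel)"
    proof (cases "s \<in> {\<rho>/4..\<rho>/2}")
      case True
      have "pi * \<rho> / 2 * cmod (H u) \<le> 2 * pi * s * cmod (H u)"
        using True by (intro mult_right_mono) (auto simp: field_simps)
      then have "ennreal (pi * \<rho> / 2 * cmod (H u)) * ?I s \<le> ennreal (2 * pi * s * cmod (H u))"
        using True by (simp add: ennreal_leI)
      also note main[of s]
      finally show ?thesis using True \<rho> by simp
    qed simp
  qed
  also have "\<dots> = ?A + ?A + ?A + ?A"
    using Gm1 by (simp only: nn_integral_add borel_measurable_add shift simp_thms)
  also have "\<dots> = (1 + 1 + 1 + 1) * ?A"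
    by (simp only: distrib_right mult_1)
  also have "\<dots> = 4 * ?A"
    by simp
  finally have "ennreal 4 * ennreal (pi * \<rho>\<^sup>2 / 32 * cmod (H u)) \<le> ennreal 4 * ?A"
    by (simp add: ennreal_mult[symmetric] mult_ac flip: ennreal_numeral)
  then show ?thesis
    by (subst (asm) ennreal_mult_le_mult_iff) (auto simp: G_def[abs_def])
qed

section \<open>Holomorphic functions of finite Dirichlet integral\<close>

lemma ball_subset_unit_disk: "ball u (1 - cmod u) \<subseteq> unit_disk"
proof
  fix w assume "w \<in> ball u (1 - cmod u)"
  then show "w \<in> unit_disk"
    using norm_triangle_ineq2[of w u] by (simp add: dist_norm norm_minus_commute)
qed

lemma dirichlet_deriv_bound:
  assumes f: "f \<in> dirichlet_space" and u: "cmod u < 1"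
  shows "((1 - cmod u) * cmod (deriv f u))\<^sup>2 \<le> 32 / pi * (LINT z:ball u (1 - cmod u)|lborel. (cmod (deriv f z))\<^sup>2)"
proof -
  let ?\<rho> = "1 - cmod u"
  have sub: "ball u ?\<rho> \<subseteq> unit_disk"
    by (rule ball_subset_unit_disk)
  have hol: "(\<lambda>z. (deriv f z)\<^sup>2) holomorphic_on ball u ?\<rho>"
    using f sub by (auto simp: dirichlet_space_def intro!: holomorphic_intros holomorphic_deriv elim: holomorphic_on_subset)
  have int: "set_integrable lborel (ball u ?\<rho>) (\<lambda>z. (cmod (deriv f z))\<^sup>2)"
    using f sub by (auto simp: dirichlet_space_def intro: set_integrable_subset)
  have "ennreal (pi * ?\<rho>\<^sup>2 / 32 * cmod ((deriv f u)\<^sup>2))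
      \<le> (\<integral>\<^sup>+z. ennreal (cmod ((deriv f z)\<^sup>2)) * indicator (ball u ?\<rho>) z \<partial>lborel)"
    using u by (intro holomorphic_mean_bound[OF hol]) auto
  also have "\<dots> = (\<integral>\<^sup>+z. ennreal (indicator (ball u ?\<rho>) z *\<^sub>R (cmod (deriv f z))\<^sup>2) \<partial>lborel)"
    by (intro nn_integral_cong) (auto simp: indicator_def norm_power)
  also have "\<dots> = ennreal (LINT z:ball u ?\<rho>|lborel. (cmod (deriv f z))\<^sup>2)"
    using int unfolding set_lebesgue_integral_def set_integrable_def by (intro nn_integral_eq_integral) auto
  finally have "pi * ?\<rho>\<^sup>2 / 32 * cmod ((deriv f u)\<^sup>2) \<le> (LINT z:ball u ?\<rho>|lborel. (cmod (deriv f z))\<^sup>2)"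
    by (subst (asm) ennreal_le_iff) (auto simp: set_lebesgue_integral_def intro!: integral_nonneg_AE)
  then show ?thesis by (simp add: norm_power power_mult_distrib pos_le_divide_eq mult_ac)
qed

lemma dirichlet_norm_nonneg: "0 \<le> dirichlet_norm f"
  unfolding dirichlet_norm_def set_lebesgue_integral_def
  by (auto intro!: add_nonneg_nonneg integral_nonneg_AE)

text \<open>Evaluation is continuous for the Dirichlet norm: the area estimate bounds \<open>f'\<close> on the segment
  from \<open>0\<close> to \<open>z\<close>.\<close>

lemma dirichlet_eval_bound:
  assumes f: "f \<in> dirichlet_space" and z: "cmod z < 1"
  shows "cmod (f z) \<le> (1 + sqrt 32 / (1 - cmod z)) * dirichlet_norm f"
proof -
  let ?N = "dirichlet_norm f"
  let ?I = "LINT z:unit_disk|lborel. (cmod (deriv f z))\<^sup>2"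
  have hol: "f holomorphic_on unit_disk" using f by (simp add: dirichlet_space_def)
  have I0: "0 \<le> ?I" by (auto simp: set_lebesgue_integral_def intro!: integral_nonneg_AE)
  have N2: "?N\<^sup>2 = (cmod (f 0))\<^sup>2 + 1 / pi * ?I"
    unfolding dirichlet_norm_def using I0 by (simp add: add_nonneg_nonneg)
  have f0: "cmod (f 0) \<le> ?N"
    using N2 I0 by (intro power2_le_imp_le[OF _ dirichlet_norm_nonneg]) auto
  have d: "cmod (deriv f u) \<le> sqrt 32 / (1 - cmod z) * ?N" if u: "u \<in> closed_segment 0 z" for u
  proof -
    have uz: "cmod u \<le> cmod z" using u by (rule segment_bound(1)[of u 0 z, simplified])
    have sub: "ball u (1 - cmod u) \<subseteq> unit_disk"
      by (rule ball_subset_unit_disk)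
    have "((1 - cmod z) * cmod (deriv f u))\<^sup>2 \<le> ((1 - cmod u) * cmod (deriv f u))\<^sup>2"
      using uz z by (intro power_mono mult_right_mono) auto
    also have "\<dots> \<le> 32 / pi * (LINT z:ball u (1 - cmod u)|lborel. (cmod (deriv f z))\<^sup>2)"
      using dirichlet_deriv_bound[OF f, of u] uz z by simp
    also have "\<dots> \<le> 32 / pi * ?I"
    proof (intro mult_left_mono)
      show "(LINT z:ball u (1 - cmod u)|lborel. (cmod (deriv f z))\<^sup>2) \<le> ?I"
        unfolding set_lebesgue_integral_def
      proof (rule integral_mono)
        have int: "set_integrable lborel unit_disk (\<lambda>z. (cmod (deriv f z))\<^sup>2)"
          using f by (simp add: dirichlet_space_def)
        show "integrable lborel (\<lambda>z. indicat_real unit_disk z *\<^sub>R (cmod (deriv f z))\<^sup>2)"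
          using int by (simp only: set_integrable_def)
        show "integrable lborel (\<lambda>z. indicat_real (ball u (1 - cmod u)) z *\<^sub>R (cmod (deriv f z))\<^sup>2)"
          using set_integrable_subset[OF int _ sub] by (simp only: set_integrable_def) simp
        show "indicat_real (ball u (1 - cmod u)) z *\<^sub>R (cmod (deriv f z))\<^sup>2
            \<le> indicat_real unit_disk z *\<^sub>R (cmod (deriv f z))\<^sup>2" for z
          using subsetD[OF sub, of z] by (auto simp only: indicator_def scaleR_one split: if_splits) auto
      qed
    qed auto
    also have "\<dots> \<le> 32 * ?N\<^sup>2" using N2 by simp
    also have "\<dots> = (sqrt 32 * ?N)\<^sup>2" by (simp add: power_mult_distrib)
    finally have "(1 - cmod z) * cmod (deriv f u) \<le> sqrt 32 * ?N"
      by (rule power2_le_imp_le) (auto intro!: mult_nonneg_nonneg dirichlet_norm_nonneg)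
    then show ?thesis using z by (simp add: field_simps)
  qed
  have "cmod (f z - f 0) \<le> (sqrt 32 / (1 - cmod z) * ?N) * cmod (z - 0)"
  proof (rule field_differentiable_bound[where S="closed_segment 0 z" and f'="deriv f"])
    fix u assume u: "u \<in> closed_segment 0 z"
    have "cmod u < 1" using segment_bound(1)[OF u] z by simp
    then show "(f has_field_derivative deriv f u) (at u within closed_segment 0 z)"
      by (simp add: has_field_derivative_at_within[OF holomorphic_derivI[OF hol open_ball]])
    show "cmod (deriv f u) \<le> sqrt 32 / (1 - cmod z) * ?N" by (rule d[OF u])
  qed auto
  also have "\<dots> \<le> (sqrt 32 / (1 - cmod z) * ?N) * 1"
    using z dirichlet_norm_nonneg[of f] by (intro mult_left_mono) auto
  finally have "cmod (f z - f 0) \<le> sqrt 32 / (1 - cmod z) * ?N" by simp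
  then show ?thesis using f0 norm_triangle_sub[of "f z" "f 0"] by (simp add: algebra_simps)
qed

lemma dirichlet_space_diff:
  assumes f: "f \<in> dirichlet_space" and g: "g \<in> dirichlet_space"
  shows "(\<lambda>z. f z - g z) \<in> dirichlet_space"
proof -
  have hol: "f holomorphic_on unit_disk" "g holomorphic_on unit_disk"
    using f g by (auto simp: dirichlet_space_def)
  have deq: "deriv (\<lambda>z. f z - g z) z = deriv f z - deriv g z" if "z \<in> unit_disk" for z
    using hol that by (intro deriv_diff) (auto simp: holomorphic_on_imp_differentiable_at)
  have "set_integrable lborel unit_disk (\<lambda>z. 2 * (cmod (deriv f z))\<^sup>2 + 2 * (cmod (deriv g z))\<^sup>2)"
    using f g by (intro set_integral_add set_integrable_mult_right) (auto simp: dirichlet_space_def)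
  then have "set_integrable lborel unit_disk (\<lambda>z. (cmod (deriv (\<lambda>z. f z - g z) z))\<^sup>2)"
    unfolding set_integrable_def
  proof (rule Bochner_Integration.integrable_bound)
    have "continuous_on unit_disk (\<lambda>z. (cmod (deriv (\<lambda>z. f z - g z) z))\<^sup>2)"
      using hol by (intro continuous_intros holomorphic_on_imp_continuous_on holomorphic_deriv holomorphic_intros) auto
    then have "(\<lambda>x. indicat_real unit_disk x *\<^sub>R (cmod (deriv (\<lambda>z. f z - g z) x))\<^sup>2) \<in> borel_measurable borel"
      by (intro borel_measurable_continuous_on_indicator) auto
    then show "(\<lambda>x. indicat_real unit_disk x *\<^sub>R (cmod (deriv (\<lambda>z. f z - g z) x))\<^sup>2) \<in> borel_measurable lborel"
      by (simp only: measurable_lborel2)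
    have "(cmod (a - b))\<^sup>2 \<le> 2 * (cmod a)\<^sup>2 + 2 * (cmod b)\<^sup>2" for a b :: complex
    proof -
      have "(cmod (a - b))\<^sup>2 \<le> (cmod a + cmod b)\<^sup>2" by (intro power_mono norm_triangle_ineq4) auto
      also have "\<dots> \<le> 2 * (cmod a)\<^sup>2 + 2 * (cmod b)\<^sup>2"
        using zero_le_power2[of "cmod a - cmod b"] by (simp add: power2_eq_square algebra_simps)
      finally show ?thesis .
    qed
    then show "AE x in lborel. norm (indicat_real unit_disk x *\<^sub>R (cmod (deriv (\<lambda>z. f z - g z) x))\<^sup>2)
        \<le> norm (indicat_real unit_disk x *\<^sub>R (2 * (cmod (deriv f x))\<^sup>2 + 2 * (cmod (deriv g x))\<^sup>2))"
      by (intro AE_I2) (auto simp: indicator_def deq)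
  qed
  then show ?thesis
    using hol by (auto simp: dirichlet_space_def intro!: holomorphic_intros)
qed

lemma dirichlet_tendsto_pointwise:
  assumes lim: "dirichlet_tendsto F g A" and z: "cmod z < 1"
  shows "((\<lambda>t. F t z) \<longlongrightarrow> g z) A"
proof -
  let ?K = "1 + sqrt 32 / (1 - cmod z)"
  have "((\<lambda>t. ?K * dirichlet_norm (\<lambda>z. F t z - g z)) \<longlongrightarrow> ?K * 0) A"
    using lim by (intro tendsto_intros) (auto simp: dirichlet_tendsto_def)
  moreover have "\<forall>\<^sub>F t in A. norm (F t z - g z) \<le> ?K * dirichlet_norm (\<lambda>z. F t z - g z)"
    using lim unfolding dirichlet_tendsto_def
    by (auto elim!: eventually_mono intro!: dirichlet_eval_bound[OF dirichlet_space_diff z])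
  ultimately have "((\<lambda>t. F t z - g z) \<longlongrightarrow> 0) A"
    by (simp add: Lim_null_comparison)
  then show ?thesis by (simp add: LIM_zero_iff)
qed

text \<open>The area estimate on the disk of radius \<open>1 - |u n|\<close> about \<open>u n\<close>; these disks leave every point of
  the unit disk, so the Dirichlet integral over them tends to \<open>0\<close> by dominated convergence.\<close>

lemma dirichlet_little_bloch:
  assumes f: "f \<in> dirichlet_space" and u: "\<And>n. cmod (u n) < 1" and lim: "(\<lambda>n. cmod (u n)) \<longlonglongrightarrow> 1"
  shows "(\<lambda>n. (1 - cmod (u n)) * cmod (deriv f (u n))) \<longlonglongrightarrow> 0"
proof -
  let ?I = "\<lambda>n. LINT z:ball (u n) (1 - cmod (u n))|lborel. (cmod (deriv f z))\<^sup>2"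
  let ?w = "\<lambda>z. indicator unit_disk z *\<^sub>R (cmod (deriv f z))\<^sup>2"
  have wint: "integrable lborel ?w"
    using f by (simp add: dirichlet_space_def set_integrable_def)
  have sub: "ball (u n) (1 - cmod (u n)) \<subseteq> unit_disk" for n
    by (rule ball_subset_unit_disk)
  have "?I \<longlonglongrightarrow> integral\<^sup>L lborel (\<lambda>z::complex. 0::real)"
    unfolding set_lebesgue_integral_def
  proof (rule integral_dominated_convergence[OF _ _ wint])
    show "(\<lambda>z. indicat_real (ball (u n) (1 - cmod (u n))) z *\<^sub>R (cmod (deriv f z))\<^sup>2) \<in> borel_measurable lborel" for n
      using f sub[of n] set_integrable_subset[of lborel unit_disk "\<lambda>z. (cmod (deriv f z))\<^sup>2" "ball (u n) (1 - cmod (u n))"]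
      by (auto simp: dirichlet_space_def set_integrable_def)
    show "AE z in lborel. (\<lambda>n. indicat_real (ball (u n) (1 - cmod (u n))) z *\<^sub>R (cmod (deriv f z))\<^sup>2) \<longlonglongrightarrow> 0"
    proof (intro AE_I2)
      fix z :: complex
      have "\<forall>\<^sub>F n in sequentially. indicat_real (ball (u n) (1 - cmod (u n))) z *\<^sub>R (cmod (deriv f z))\<^sup>2 = 0"
      proof (cases "cmod z < 1")
        case True
        then have "\<forall>\<^sub>F n in sequentially. (1 + cmod z) / 2 < cmod (u n)"
          by (intro order_tendstoD(1)[OF lim]) auto
        then show ?thesis
        proof eventually_elim
          case (elim n)
          have "\<not> cmod (u n - z) < 1 - cmod (u n)"
            using norm_triangle_ineq2[of "u n" z] elim by argo
          then show ?case by (simp add: dist_norm)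
        qed
      next
        case False
        have "indicat_real (ball (u n) (1 - cmod (u n))) z = 0" for n
        proof -
          have "z \<notin> ball (u n) (1 - cmod (u n))"
            using False sub[of n] by (meson mem_ball_0 subsetD)
          then show ?thesis by (rule indicator_simps(2))
        qed
        then show ?thesis by (intro always_eventually allI) (simp only: scaleR_zero_left)
      qed
      then show "(\<lambda>n. indicat_real (ball (u n) (1 - cmod (u n))) z *\<^sub>R (cmod (deriv f z))\<^sup>2) \<longlonglongrightarrow> 0"
        by (rule tendsto_eventually)
    qed
    show "AE z in lborel. norm (indicat_real (ball (u n) (1 - cmod (u n))) z *\<^sub>R (cmod (deriv f z))\<^sup>2) \<le> ?w z" for n
      using sub[of n] by (intro AE_I2) (auto simp: indicator_def)
  qed auto
  then have "(\<lambda>n. 32 / pi * ?I n) \<longlonglongrightarrow> 32 / pi * 0"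
    by (intro tendsto_intros) simp
  then have "(\<lambda>n. ((1 - cmod (u n)) * cmod (deriv f (u n)))\<^sup>2) \<longlonglongrightarrow> 0"
  proof (rule Lim_null_comparison[rotated, OF tendsto_eq_rhs])
    show "\<forall>\<^sub>F n in sequentially. norm (((1 - cmod (u n)) * cmod (deriv f (u n)))\<^sup>2) \<le> 32 / pi * ?I n"
      using dirichlet_deriv_bound[OF f u] by (intro always_eventually allI) (simp only: real_norm_def abs_power2)
  qed simp
  then have "(\<lambda>n. sqrt (((1 - cmod (u n)) * cmod (deriv f (u n)))\<^sup>2)) \<longlonglongrightarrow> sqrt 0"
    by (rule tendsto_real_sqrt)
  then show ?thesis using u by (simp add: less_imp_le)
qed

text \<open>The two distance conditions say that \<open>z n\<close> and \<open>w n\<close> are at bounded hyperbolic distance, in a form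
  that passes to the points of the segment between them because \<open>1 - |u|\<close> is concave along it.\<close>

lemma dirichlet_diff_tendsto_0:
  assumes f: "f \<in> dirichlet_space" and z: "\<And>n. cmod (z n) < 1" and w: "\<And>n. cmod (w n) < 1"
    and lim: "(\<lambda>n. cmod (z n)) \<longlonglongrightarrow> 1"
    and zw: "\<And>n. cmod (z n - w n) \<le> K * (1 - cmod (z n))" and wz: "\<And>n. cmod (z n - w n) \<le> K * (1 - cmod (w n))"
  shows "(\<lambda>n. f (z n) - f (w n)) \<longlonglongrightarrow> 0"
proof -
  have hol: "f holomorphic_on unit_disk" using f by (simp add: dirichlet_space_def)
  have "\<exists>u\<in>closed_segment (z n) (w n). cmod (f (z n) - f (w n)) \<le> cmod (z n - w n) * cmod (deriv f u)" for n
  proof -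
    have seg: "closed_segment (z n) (w n) \<subseteq> unit_disk"
      using z[of n] w[of n] by (simp add: closed_segment_subset)
    let ?p = "\<lambda>x. linepath (w n) (z n) x"
    have pin: "?p x \<in> closed_segment (z n) (w n)" if "x \<in> {0..1}" for x
      using that linepath_in_path[of x "w n" "z n"] by (simp add: closed_segment_commute)
    have "\<exists>x\<in>{0<..<1}. cmod ((f \<circ> ?p) 1 - (f \<circ> ?p) 0) \<le> cmod ((deriv f (?p x) * (z n - w n)) * of_real (1 - 0))"
    proof (rule mvt_general)
      show "continuous_on {0..1} (f \<circ> ?p)"
        using pin seg by (intro continuous_on_compose continuous_on_linepath
          continuous_on_subset[OF holomorphic_on_imp_continuous_on[OF hol]]) auto
      fix x :: real assume "0 < x" "x < 1"
      then have "?p x \<in> unit_disk" using pin[of x] seg by auto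
      then have "(f has_field_derivative deriv f (?p x)) (at (?p x))"
        by (intro holomorphic_derivI[OF hol]) auto
      moreover have "(?p has_vector_derivative (z n - w n)) (at x)"
        by (rule has_vector_derivative_linepath_within)
      ultimately have "(f \<circ> ?p has_vector_derivative (z n - w n) * deriv f (?p x)) (at x)"
        by (intro field_vector_diff_chain_at)
      then show "(f \<circ> ?p has_derivative (\<lambda>h. (deriv f (?p x) * (z n - w n)) * of_real h)) (at x)"
        by (simp add: has_vector_derivative_def scaleR_conv_of_real mult_ac)
    qed auto
    then obtain x where "x \<in> {0<..<1}" "cmod (f (z n) - f (w n)) \<le> cmod (deriv f (?p x)) * cmod (z n - w n)"
      by (auto simp: linepath_0' linepath_1' norm_mult)
    then show ?thesis using pin[of x] by (intro bexI[of _ "?p x"]) (auto simp: mult_ac)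
  qed
  \<comment> \<open>The mean value points \<open>u n\<close> again tend to the circle, where \<open>(1 - |u|) |f' u|\<close> is small.\<close>
  then obtain u where u: "\<And>n. u n \<in> closed_segment (z n) (w n)"
    and fu: "\<And>n. cmod (f (z n) - f (w n)) \<le> cmod (z n - w n) * cmod (deriv f (u n))"
    by metis
  have u1: "cmod (u n) < 1" for n
    using u[of n] z[of n] w[of n] closed_segment_subset[of "z n" "ball 0 1" "w n"] by auto
  have near: "cmod (z n - w n) \<le> K * (1 - cmod (u n))" for n
  proof -
    have "u n \<in> cball 0 (max (cmod (z n)) (cmod (w n)))"
      using u[of n] closed_segment_subset[of "z n" "cball 0 (max (cmod (z n)) (cmod (w n)))" "w n"] by auto
    then have "cmod (u n) \<le> max (cmod (z n)) (cmod (w n))" by simp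
    then have le: "min (1 - cmod (z n)) (1 - cmod (w n)) \<le> 1 - cmod (u n)" by auto
    show ?thesis
    proof (cases "K \<ge> 0")
      case True
      have "cmod (z n - w n) \<le> K * min (1 - cmod (z n)) (1 - cmod (w n))"
        using zw[of n] wz[of n] by (auto simp: min_def)
      then show ?thesis using mult_left_mono[OF le True] by linarith
    next
      case False
      then have "K * (1 - cmod (z n)) < 0" using z[of n] by (simp add: mult_neg_pos)
      then show ?thesis using zw[of n] norm_ge_zero[of "z n - w n"] by linarith
    qed
  qed
  have ulim: "(\<lambda>n. cmod (u n)) \<longlonglongrightarrow> 1"
  proof (rule tendsto_sandwich[OF _ _ _ tendsto_const])
    have "cmod (u n - z n) \<le> K * (1 - cmod (z n))" for n
      using segment_bound(1)[OF u[of n]] zw[of n] by (simp add: norm_minus_commute)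
    then have "1 - (1 + K) * (1 - cmod (z n)) \<le> cmod (u n)" for n
      using norm_triangle_ineq2[of "z n" "u n"] by (simp add: algebra_simps norm_minus_commute) (smt (verit))
    then show "\<forall>\<^sub>F n in sequentially. 1 - (1 + K) * (1 - cmod (z n)) \<le> cmod (u n)" by simp
    have "(\<lambda>n. 1 - (1 + K) * (1 - cmod (z n))) \<longlonglongrightarrow> 1 - (1 + K) * (1 - 1)"
      by (intro tendsto_intros lim)
    then show "(\<lambda>n. 1 - (1 + K) * (1 - cmod (z n))) \<longlonglongrightarrow> 1" by simp
  qed (use u1 in \<open>auto simp: less_imp_le\<close>)
  show ?thesis
  proof (rule Lim_null_comparison)
    show "\<forall>\<^sub>F n in sequentially. cmod (f (z n) - f (w n)) \<le> K * ((1 - cmod (u n)) * cmod (deriv f (u n)))"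
    proof (intro always_eventually allI)
      fix n
      show "cmod (f (z n) - f (w n)) \<le> K * ((1 - cmod (u n)) * cmod (deriv f (u n)))"
        using order_trans[OF fu mult_right_mono[OF near norm_ge_zero]] by (simp only: mult.assoc)
    qed
    show "(\<lambda>n. K * ((1 - cmod (u n)) * cmod (deriv f (u n)))) \<longlonglongrightarrow> 0"
      by (intro tendsto_mult_right_zero dirichlet_little_bloch f u1 ulim)
  qed
qed

section \<open>Schwarz-Pick inequalities and the Cayley transform\<close>

text \<open>This is \<open>cosh\<^sup>2 d\<close> for the hyperbolic distance \<open>d\<close> with \<open>tanh d = |z - w| / |1 - cnj z w|\<close>. It expresses
  boundedness of \<open>d\<close> by a rational expression, and it becomes \<open>|\<zeta> + cnj \<omega>|\<^sup>2 / (4 Re \<zeta> Re \<omega>)\<close> in the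
  right half-plane.\<close>

definition pick_ratio :: "complex \<Rightarrow> complex \<Rightarrow> real" where
  "pick_ratio z w = (cmod (1 - cnj z * w))\<^sup>2 / ((1 - (cmod z)\<^sup>2) * (1 - (cmod w)\<^sup>2))"

lemma cnj_mult_neq_1:
  assumes "cmod z < 1" "cmod w < 1"
  shows "1 - cnj z * w \<noteq> 0"
proof
  assume "1 - cnj z * w = 0"
  then have "cmod z * cmod w = 1"
    by (metis complex_mod_cnj eq_iff_diff_eq_0 norm_mult norm_one)
  moreover have "cmod z * cmod w < 1 * 1"
    using assms by (intro mult_strict_mono') auto
  ultimately show False by simp
qed

lemma norm_one_minus_cnj_mult_commute: "cmod (1 - cnj w * z) = cmod (1 - cnj z * w)"
proof -
  have "1 - cnj w * z = cnj (1 - cnj z * w)" by (simp add: mult.commute)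
  then show ?thesis by (simp only: complex_mod_cnj)
qed

lemma norm_one_minus_cnj_mult_sq:
  "(cmod (1 - cnj z * w))\<^sup>2 = (cmod (z - w))\<^sup>2 + (1 - (cmod z)\<^sup>2) * (1 - (cmod w)\<^sup>2)"
  unfolding cmod_power2 by (simp add: power2_eq_square algebra_simps)

lemma one_minus_norm_sq_pos: "cmod z < 1 \<Longrightarrow> 0 < 1 - (cmod z)\<^sup>2"
  by (simp add: power_less_one_iff)

lemma one_minus_norm_Moebius_sq:
  assumes "cmod z < 1" "cmod w < 1"
  shows "1 - (cmod (Moebius_function 0 w z))\<^sup>2 = 1 / pick_ratio z w"
proof -
  have ne: "1 - cnj w * z \<noteq> 0" "1 - cnj z * w \<noteq> 0" using cnj_mult_neq_1 assms by blast+
  have "1 - (cmod (Moebius_function 0 w z))\<^sup>2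
      = ((cmod (1 - cnj z * w))\<^sup>2 - (cmod (z - w))\<^sup>2) / (cmod (1 - cnj z * w))\<^sup>2"
    unfolding Moebius_function_simple norm_divide power_divide
    using ne norm_one_minus_cnj_mult_commute[of w z] by (simp add: diff_divide_distrib)
  then show ?thesis
    using norm_one_minus_cnj_mult_sq[of z w] by (simp add: pick_ratio_def)
qed

lemma pick_ratio_pos:
  assumes "cmod z < 1" "cmod w < 1"
  shows "0 < pick_ratio z w"
  unfolding pick_ratio_def using assms cnj_mult_neq_1[OF assms]
  by (intro divide_pos_pos mult_pos_pos one_minus_norm_sq_pos) auto

lemma Schwarz_Pick:
  assumes hol: "f holomorphic_on unit_disk" and im: "f ` unit_disk \<subseteq> unit_disk"
    and z: "cmod z < 1" and w: "cmod w < 1"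
  shows "pick_ratio (f z) (f w) \<le> pick_ratio z w"
proof -
  have fz: "cmod (f v) < 1" if "cmod v < 1" for v using im that by (auto simp: image_subset_iff)
  define g where "g = Moebius_function 0 (f w) \<circ> f \<circ> Moebius_function 0 (-w)"
  have M: "cmod (Moebius_function 0 a v) < 1" if "cmod a < 1" "cmod v < 1" for a v
    using that by (rule Moebius_function_norm_lt_1)
  have "g holomorphic_on ball 0 1"
    unfolding g_def
  proof (intro holomorphic_on_compose)
    show "Moebius_function 0 (-w) holomorphic_on ball 0 1"
      using w by (intro Moebius_function_holomorphic) simp
    have sub: "Moebius_function 0 (-w) ` unit_disk \<subseteq> unit_disk"
      using M[of "-w"] w by auto
    show "f holomorphic_on Moebius_function 0 (-w) ` unit_disk"
      using hol sub by (rule holomorphic_on_subset)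
    show "Moebius_function 0 (f w) holomorphic_on f ` Moebius_function 0 (-w) ` unit_disk"
      using sub fz by (intro holomorphic_on_subset[OF Moebius_function_holomorphic[OF fz[OF w]]]) (auto simp: image_subset_iff)
  qed
  moreover have "g 0 = 0"
    by (simp add: g_def Moebius_function_simple)
  moreover have "cmod (g v) < 1" if "cmod v < 1" for v
    using that w fz M by (simp add: g_def)
  ultimately have "cmod (g (Moebius_function 0 w z)) \<le> cmod (Moebius_function 0 w z)"
    using M[OF w z] by (rule Schwarz_Lemma(1))
  moreover have "Moebius_function 0 (-w) (Moebius_function 0 w z) = z"
    using w z by (intro Moebius_function_compose) auto
  ultimately have "(cmod (Moebius_function 0 (f w) (f z)))\<^sup>2 \<le> (cmod (Moebius_function 0 w z))\<^sup>2"
    by (simp add: g_def power_mono)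
  then have "1 / pick_ratio z w \<le> 1 / pick_ratio (f z) (f w)"
    using one_minus_norm_Moebius_sq[OF z w] one_minus_norm_Moebius_sq[OF fz[OF z] fz[OF w]] by linarith
  then show ?thesis
    using pick_ratio_pos[OF z w] pick_ratio_pos[OF fz[OF z] fz[OF w]] by (simp add: field_simps)
qed

text \<open>The map \<open>\<zeta> \<mapsto> (\<zeta> - 1) / (\<zeta> + 1)\<close> takes the right half-plane to the disk and turns the ratio of the
  images into \<open>|P z + cnj (P w)|\<^sup>2 / (4 Re (P z) Re (P w))\<close>.\<close>

lemma Schwarz_Pick_halfplane_strict:
  assumes hol: "P holomorphic_on unit_disk" and pos: "\<And>z. cmod z < 1 \<Longrightarrow> 0 < Re (P z)"
    and z: "cmod z < 1" and w: "cmod w < 1"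
  shows "(cmod (P z + cnj (P w)))\<^sup>2 \<le> 4 * Re (P z) * Re (P w) * pick_ratio z w"
proof -
  define f where "f v = (P v - 1) / (P v + 1)" for v
  have ne: "P v + 1 \<noteq> 0" if "cmod v < 1" for v
    using pos[OF that] by (auto simp: complex_eq_iff)
  have sq: "1 - (cmod (f v))\<^sup>2 = 4 * Re (P v) / (cmod (P v + 1))\<^sup>2" if "cmod v < 1" for v
  proof -
    have "(cmod (P v + 1))\<^sup>2 - (cmod (P v - 1))\<^sup>2 = 4 * Re (P v)"
      unfolding cmod_power2 by (simp add: power2_eq_square algebra_simps)
    then show ?thesis
      using ne[OF that] by (simp add: f_def norm_divide power_divide diff_divide_eq_iff)
  qed
  have f1: "cmod (f v) < 1" if "cmod v < 1" for v
  proof -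
    have "0 < 1 - (cmod (f v))\<^sup>2"
      unfolding sq[OF that] using pos[OF that] ne[OF that] by simp
    then show ?thesis by (simp add: abs_square_less_1)
  qed
  have "f holomorphic_on unit_disk"
    unfolding f_def using ne hol by (intro holomorphic_intros) auto
  then have le: "pick_ratio (f z) (f w) \<le> pick_ratio z w"
    using f1 by (intro Schwarz_Pick z w) auto
  have eq: "1 - cnj (f z) * f w = 2 * (cnj (P z) + P w) / ((cnj (P z) + 1) * (P w + 1))"
  proof -
    have "cnj (P z) + 1 \<noteq> 0" using ne[OF z] by (metis complex_cnj_add complex_cnj_one complex_cnj_zero_iff)
    then show ?thesis using ne[OF w] by (simp add: f_def divide_simps) (simp add: algebra_simps)
  qed
  have "cmod (1 - cnj (f z) * f w) = 2 * cmod (P z + cnj (P w)) / (cmod (P z + 1) * cmod (P w + 1))"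
  proof -
    have "cmod (cnj (P z) + P w) = cmod (P z + cnj (P w))"
      using complex_mod_cnj[of "P z + cnj (P w)"] by (simp del: complex_mod_cnj)
    moreover have "cmod (cnj (P z) + 1) = cmod (P z + 1)"
      using complex_mod_cnj[of "P z + 1"] by (simp del: complex_mod_cnj)
    ultimately show ?thesis
      using eq by (simp only: norm_divide norm_mult norm_numeral)
  qed
  then have "pick_ratio (f z) (f w) = (cmod (P z + cnj (P w)))\<^sup>2 / (4 * Re (P z) * Re (P w))"
    using ne[OF z] ne[OF w] by (simp add: pick_ratio_def sq z w power_divide power_mult_distrib)
  then show ?thesis
    using le pos[OF z] pos[OF w] by (simp add: pos_divide_le_eq mult_ac)
qed

text \<open>Boundary values of the real part are admitted by applying the strict case to \<open>P + d\<close> and letting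
  \<open>d \<rightarrow> 0\<close>.\<close>

lemma Schwarz_Pick_halfplane:
  assumes hol: "P holomorphic_on unit_disk" and pos: "\<And>z. cmod z < 1 \<Longrightarrow> 0 \<le> Re (P z)"
    and z: "cmod z < 1" and w: "cmod w < 1"
  shows "(cmod (P z + cnj (P w)))\<^sup>2 \<le> 4 * Re (P z) * Re (P w) * pick_ratio z w"
proof -
  let ?L = "\<lambda>d. (cmod ((P z + of_real d) + cnj (P w + of_real d)))\<^sup>2"
  let ?R = "\<lambda>d. 4 * Re (P z + of_real d) * Re (P w + of_real d) * pick_ratio z w"
  have le: "?L d \<le> ?R d" if "d > 0" for d
    using that pos by (intro Schwarz_Pick_halfplane_strict[where P="\<lambda>v. P v + of_real d"])
      (auto intro!: holomorphic_intros hol z w add_nonneg_pos)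
  have "?L 0 \<le> ?R 0"
  proof (rule tendsto_le)
    show "(?R \<longlongrightarrow> ?R 0) (at_right 0)" "(?L \<longlongrightarrow> ?L 0) (at_right 0)"
      by (intro tendsto_intros)+
    show "\<forall>\<^sub>F d in at_right 0. ?L d \<le> ?R d"
      using eventually_at_right_less[of "0::real"] by eventually_elim (rule le)
  qed simp
  then show ?thesis by simp
qed

text \<open>Hyperbolic distance in Euclidean terms, in the form required by \<open>dirichlet_diff_tendsto_0\<close>. Both
  bounds come from \<open>|z - w| \<le> |1 - cnj z w|\<close> together with \<open>1 - |z| \<le> |1 - cnj z w|\<close>.\<close>

lemma pick_ratio_imp_close:
  assumes z: "cmod z < 1" and w: "cmod w < 1" and M: "pick_ratio z w \<le> M"
  shows "cmod (z - w) \<le> 4 * M * (1 - cmod z)" "cmod (z - w) \<le> 4 * M * (1 - cmod w)"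
proof -
  let ?a = "cmod (1 - cnj z * w)"
  have a0: "?a > 0" using cnj_mult_neq_1[OF z w] by simp
  have zw: "cmod (z * cnj w) \<le> cmod z" "cmod (z * cnj w) \<le> cmod w"
    using z w by (auto simp: norm_mult mult_left_le mult_left_le_one_le)
  have ra: "?a \<ge> 1 - cmod (z * cnj w)"
    using norm_triangle_ineq2[of 1 "cnj z * w"] by (simp add: norm_mult)
  have M0: "0 < M" using pick_ratio_pos[OF z w] M by simp
  have sq: "1 - (cmod v)\<^sup>2 \<le> 2 * (1 - cmod v)" for v
    using zero_le_power2[of "1 - cmod v"] by (simp add: power2_eq_square algebra_simps)
  have main: "?a\<^sup>2 \<le> M * ((1 - (cmod z)\<^sup>2) * (1 - (cmod w)\<^sup>2))"
    using M mult_pos_pos[OF one_minus_norm_sq_pos[OF z] one_minus_norm_sq_pos[OF w]]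
    by (simp add: pick_ratio_def pos_divide_le_eq)
  have da: "cmod (z - w) \<le> ?a"
  proof (rule power2_le_imp_le)
    show "(cmod (z - w))\<^sup>2 \<le> ?a\<^sup>2"
      using norm_one_minus_cnj_mult_sq[of z w] mult_pos_pos[OF one_minus_norm_sq_pos[OF z] one_minus_norm_sq_pos[OF w]] by linarith
  qed simp
  have "?a * ?a \<le> ?a * (4 * M * (1 - cmod z))"
  proof -
    have "(1 - (cmod z)\<^sup>2) * (1 - (cmod w)\<^sup>2) \<le> (2 * (1 - cmod z)) * (2 * ?a)"
      using sq[of z] sq[of w] ra zw z w one_minus_norm_sq_pos[OF w] by (intro mult_mono) auto
    from mult_left_mono[OF this, of M]
    have "?a\<^sup>2 \<le> M * ((2 * (1 - cmod z)) * (2 * ?a))"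
      using main M0 by linarith
    then show ?thesis by (simp add: power2_eq_square algebra_simps)
  qed
  then show "cmod (z - w) \<le> 4 * M * (1 - cmod z)"
    using a0 da by (simp only: mult_le_cancel_left_pos)
  have "?a * ?a \<le> ?a * (4 * M * (1 - cmod w))"
  proof -
    have "(1 - (cmod z)\<^sup>2) * (1 - (cmod w)\<^sup>2) \<le> (2 * ?a) * (2 * (1 - cmod w))"
      using sq[of z] sq[of w] ra zw z w one_minus_norm_sq_pos[OF w] by (intro mult_mono) auto
    from mult_left_mono[OF this, of M]
    have "?a\<^sup>2 \<le> M * ((2 * ?a) * (2 * (1 - cmod w)))"
      using main M0 by linarith
    then show ?thesis by (simp add: power2_eq_square algebra_simps)
  qed
  then show "cmod (z - w) \<le> 4 * M * (1 - cmod w)"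
    using a0 da by (simp only: mult_le_cancel_left_pos)
qed

text \<open>The conformal map of the disk onto the right half-plane that sends \<open>\<tau>\<close> to infinity; the horodisks
  at \<open>\<tau>\<close> are the sets where its real part exceeds a positive constant.\<close>

definition cayley :: "complex \<Rightarrow> complex \<Rightarrow> complex" where
  "cayley \<tau> z = (\<tau> + z) / (\<tau> - z)"

lemma cayley_denom: "cmod \<tau> = 1 \<Longrightarrow> cmod z < 1 \<Longrightarrow> \<tau> - z \<noteq> 0"
  by auto

lemma cayley_holomorphic: "cmod \<tau> = 1 \<Longrightarrow> cayley \<tau> holomorphic_on unit_disk"
  unfolding cayley_def[abs_def] by (intro holomorphic_intros) auto

lemma cayley_deriv:
  assumes "cmod \<tau> = 1" "cmod z < 1"
  shows "(cayley \<tau> has_field_derivative 2 * \<tau> / (\<tau> - z)\<^sup>2) (at z)"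
  unfolding cayley_def[abs_def]
  by (rule derivative_eq_intros | use cayley_denom[OF assms] in \<open>simp add: field_simps power2_eq_square\<close>)+

lemma Re_cayley:
  assumes \<tau>: "cmod \<tau> = 1"
  shows "Re (cayley \<tau> z) = (1 - (cmod z)\<^sup>2) / (cmod (\<tau> - z))\<^sup>2"
proof -
  have "(\<tau> + z) * cnj (\<tau> - z) = of_real ((cmod \<tau>)\<^sup>2 - (cmod z)\<^sup>2) + (z * cnj \<tau> - cnj (z * cnj \<tau>))"
    by (simp add: algebra_simps complex_norm_square del: of_real_power)
  then have "Re ((\<tau> + z) * cnj (\<tau> - z)) = 1 - (cmod z)\<^sup>2" using \<tau> by simp
  then show ?thesis
    by (simp add: cayley_def Re_divide_of_real complex_div_cnj[of "\<tau> + z"] del: complex_cnj_diff flip: of_real_power)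
qed

lemma Re_cayley_pos: "cmod \<tau> = 1 \<Longrightarrow> cmod z < 1 \<Longrightarrow> 0 < Re (cayley \<tau> z)"
  using cayley_denom[of \<tau> z] one_minus_norm_sq_pos[of z] by (simp add: Re_cayley)

text \<open>The half-plane form of Schwarz-Pick is an equality for a conformal map onto the half-plane.\<close>

lemma cayley_pick_ratio:
  assumes \<tau>: "cmod \<tau> = 1" and z: "cmod z < 1" and w: "cmod w < 1"
  shows "(cmod (cayley \<tau> z + cnj (cayley \<tau> w)))\<^sup>2 = 4 * Re (cayley \<tau> z) * Re (cayley \<tau> w) * pick_ratio z w"
proof -
  have tt: "\<tau> * cnj \<tau> = 1" using \<tau> by (simp add: complex_norm_square[symmetric])
  have ne: "\<tau> - z \<noteq> 0" "\<tau> - w \<noteq> 0" "cnj \<tau> - cnj w \<noteq> 0"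
    using cayley_denom[OF \<tau>] z w by (simp_all flip: complex_cnj_diff)
  have "cayley \<tau> z + cnj (cayley \<tau> w) = ((\<tau> + z) * (cnj \<tau> - cnj w) + (cnj \<tau> + cnj w) * (\<tau> - z)) / ((\<tau> - z) * (cnj \<tau> - cnj w))"
    using ne by (simp add: cayley_def add_frac_eq)
  also have "(\<tau> + z) * (cnj \<tau> - cnj w) + (cnj \<tau> + cnj w) * (\<tau> - z) = 2 * (1 - z * cnj w)"
    using tt by (simp add: algebra_simps)
  finally have eq': "cmod (cayley \<tau> z + cnj (cayley \<tau> w)) = 2 * cmod (1 - z * cnj w) / (cmod (\<tau> - z) * cmod (\<tau> - w))"
    by (simp only: norm_divide norm_mult complex_mod_cnj norm_numeral flip: complex_cnj_diff)
  have eq: "cmod (cayley \<tau> z + cnj (cayley \<tau> w)) = 2 * cmod (1 - cnj z * w) / (cmod (\<tau> - z) * cmod (\<tau> - w))"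
    unfolding eq' using norm_one_minus_cnj_mult_commute[of w z] by (simp add: mult.commute)
  have *: "(2 * a / (x * y))\<^sup>2 = 4 * (X / x\<^sup>2) * (Y / y\<^sup>2) * (a\<^sup>2 / (X * Y))" if "X \<noteq> 0" "Y \<noteq> 0" for a x y X Y :: real
    using that by (simp add: power_divide power_mult_distrib)
  have "1 - (cmod z)\<^sup>2 \<noteq> 0" "1 - (cmod w)\<^sup>2 \<noteq> 0"
    using one_minus_norm_sq_pos[OF z] one_minus_norm_sq_pos[OF w] by auto
  then show ?thesis
    unfolding Re_cayley[OF \<tau>] pick_ratio_def eq by (rule *)
qed

lemma cayley_surj:
  assumes \<tau>: "cmod \<tau> = 1" and d: "0 < Re d"
  obtains z where "cmod z < 1" "cayley \<tau> z = d"
proof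
  have ne: "d + 1 \<noteq> 0" using d by (auto simp: complex_eq_iff)
  let ?z = "\<tau> * (d - 1) / (d + 1)"
  have t0: "\<tau> \<noteq> 0" using \<tau> by auto
  have "(cmod (d - 1))\<^sup>2 < (cmod (d + 1))\<^sup>2"
    using d unfolding cmod_power2 by (simp add: power2_eq_square algebra_simps)
  then have "cmod (d - 1) < cmod (d + 1)" by (rule power_less_imp_less_base) simp
  then show "cmod ?z < 1" using \<tau> ne by (simp add: norm_divide norm_mult)
  have "\<tau> + ?z = 2 * \<tau> * d / (d + 1)" "\<tau> - ?z = 2 * \<tau> / (d + 1)"
    using ne by (simp_all add: field_simps)
  then show "cayley \<tau> ?z = d"
    using ne t0 by (simp add: cayley_def)
qed

section \<open>Flows, Koenigs functions and invariant horodisks\<close>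

locale koenigs_semigroup =
  fixes \<phi> :: "real \<Rightarrow> complex \<Rightarrow> complex" and h :: "complex \<Rightarrow> complex" and \<tau> :: complex
  assumes semigroup: "holomorphic_semigroup \<phi>"
    and koenigs: "koenigs_function \<phi> h"
    and denjoy_wolff: "denjoy_wolff_point \<phi> \<tau>"
begin

lemma h_holomorphic: "h holomorphic_on unit_disk"
  and h_inj: "inj_on h unit_disk"
  and h_flow: "\<lbrakk>0 \<le> t; cmod z < 1\<rbrakk> \<Longrightarrow> h (\<phi> t z) = h z + of_real t"
  using koenigs by (auto simp: koenigs_function_def)

lemma flow_holomorphic: "0 \<le> t \<Longrightarrow> \<phi> t holomorphic_on unit_disk"
  and flow_image: "0 \<le> t \<Longrightarrow> \<phi> t ` unit_disk \<subseteq> unit_disk"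
  and flow_0: "cmod z < 1 \<Longrightarrow> \<phi> 0 z = z"
  and flow_add: "\<lbrakk>0 \<le> t; 0 \<le> s; cmod z < 1\<rbrakk> \<Longrightarrow> \<phi> (t + s) z = \<phi> t (\<phi> s z)"
  using semigroup by (auto simp: holomorphic_semigroup_def)

lemma flow_in_disk: "\<lbrakk>0 \<le> t; cmod z < 1\<rbrakk> \<Longrightarrow> cmod (\<phi> t z) < 1"
  using flow_image[of t] by (auto simp: image_subset_iff)

lemma norm_tau: "cmod \<tau> = 1"
  using denjoy_wolff by (simp add: denjoy_wolff_point_def)

lemma orbit_tendsto:
  assumes "0 < t" "cmod z < 1"
  shows "(\<lambda>n. \<phi> (real n * t) z) \<longlonglongrightarrow> \<tau>"
proof -
  have "filterlim (\<lambda>n. real n * t) at_top sequentially"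
    using assms(1) by (intro filterlim_tendsto_pos_mult_at_top[OF tendsto_const] filterlim_real_sequentially
       | simp add: mult.commute[of _ t])+
  then show ?thesis
    using denjoy_wolff assms(2) by (auto simp: denjoy_wolff_point_def intro: filterlim_compose)
qed

lemma flow_tendsto_0:
  assumes "cmod z < 1"
  shows "((\<lambda>t. \<phi> t z) \<longlongrightarrow> z) (at_right 0)"
proof -
  have "uniform_limit {z} \<phi> (\<lambda>z. z) (at_right 0)"
    using semigroup assms unfolding holomorphic_semigroup_def
    by (metis compact_insert compact_empty empty_subsetI insert_subset mem_ball_0)
  then show ?thesis
    by (rule tendsto_uniform_limitI) simp
qed

lemma deriv_h_nonzero:
  assumes "cmod z < 1"
  shows "deriv h z \<noteq> 0"
  using holomorphic_injective_imp_regular[OF h_holomorphic open_ball h_inj, of z] assms by simp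

text \<open>In the coordinate \<open>h\<close> the flow is translation, so its velocity at \<open>z\<close> is \<open>1 / h' z\<close>.\<close>

lemma deriv_along_flow:
  assumes g: "g holomorphic_on unit_disk" and z: "cmod z < 1"
  shows "((\<lambda>t. (g (\<phi> t z) - g z) / of_real t) \<longlongrightarrow> deriv g z / deriv h z) (at_right 0)"
proof -
  have ne: "\<phi> t z \<noteq> z" if "t > 0" for t
  proof
    assume "\<phi> t z = z"
    then show False using h_flow[of t z] that z by simp
  qed
  have lim: "filterlim (\<lambda>t. \<phi> t z) (at z) (at_right 0)"
    using flow_tendsto_0[OF z] eventually_at_right_less[of "0::real"]
    by (intro filterlim_atI) (auto elim!: eventually_mono simp: ne)
  have quot: "((\<lambda>t. (k (\<phi> t z) - k z) / (\<phi> t z - z)) \<longlongrightarrow> deriv k z) (at_right 0)"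
    if "k holomorphic_on unit_disk" for k
  proof -
    have "(k has_field_derivative deriv k z) (at z)"
      using that z by (intro holomorphic_derivI[OF that open_ball]) auto
    then show ?thesis
      using lim by (auto simp: has_field_derivative_iff intro: filterlim_compose)
  qed
  have "((\<lambda>t. ((g (\<phi> t z) - g z) / (\<phi> t z - z)) / ((h (\<phi> t z) - h z) / (\<phi> t z - z)))
      \<longlongrightarrow> deriv g z / deriv h z) (at_right 0)"
    by (intro tendsto_divide quot g h_holomorphic deriv_h_nonzero z)
  moreover have "\<forall>\<^sub>F t in at_right 0. ((g (\<phi> t z) - g z) / (\<phi> t z - z)) / ((h (\<phi> t z) - h z) / (\<phi> t z - z))
      = (g (\<phi> t z) - g z) / of_real t"
    using eventually_at_right_less[of "0::real"]
  proof eventually_elim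
    case (elim t)
    then show ?case using ne[of t] h_flow[of t z] z by simp
  qed
  ultimately show ?thesis
    by (rule Lim_transform_eventually)
qed

lemma eigenfunction_form:
  assumes gen: "dirichlet_generator \<phi> f (\<lambda>z. \<mu> * f z)"
  obtains c where "\<And>z. cmod z < 1 \<Longrightarrow> f z = c * exp (\<mu> * h z)"
proof -
  have f: "f holomorphic_on unit_disk"
    using gen by (simp add: dirichlet_generator_def dirichlet_space_def)
  have df: "deriv f z = \<mu> * f z * deriv h z" if z: "cmod z < 1" for z
  proof -
    have "((\<lambda>t. (f (\<phi> t z) - f z) / of_real t) \<longlongrightarrow> \<mu> * f z) (at_right 0)"
      using gen dirichlet_tendsto_pointwise[OF _ z] unfolding dirichlet_generator_def composition_operator_def
      by fastforce
    then have "deriv f z / deriv h z = \<mu> * f z"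
      using tendsto_unique[OF _ deriv_along_flow[OF f z]] by simp
    then show ?thesis using deriv_h_nonzero[OF z] by (simp add: field_simps)
  qed
  have "((\<lambda>z. f z * exp (- (\<mu> * h z))) has_field_derivative 0) (at z within unit_disk)" if z: "z \<in> unit_disk" for z
  proof -
    have "(f has_field_derivative deriv f z) (at z)" "(h has_field_derivative deriv h z) (at z)"
      using z by (auto intro!: holomorphic_derivI[OF f] holomorphic_derivI[OF h_holomorphic])
    then have "((\<lambda>z. f z * exp (- (\<mu> * h z))) has_field_derivative
        f z * (exp (- (\<mu> * h z)) * - (\<mu> * deriv h z)) + deriv f z * exp (- (\<mu> * h z))) (at z)"
      by (intro DERIV_mult' DERIV_fun_exp DERIV_minus DERIV_cmult)
    moreover have "f z * (exp (- (\<mu> * h z)) * - (\<mu> * deriv h z)) + deriv f z * exp (- (\<mu> * h z)) = 0"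
      using df z by (simp add: algebra_simps)
    ultimately show ?thesis by (simp add: has_field_derivative_at_within)
  qed
  then obtain c where c: "\<And>z. z \<in> unit_disk \<Longrightarrow> f z * exp (- (\<mu> * h z)) = c"
    using has_field_derivative_zero_constant[OF convex_ball, of 0 1 "\<lambda>z. f z * exp (- (\<mu> * h z))"] by blast
  have "f z = c * exp (\<mu> * h z)" if "cmod z < 1" for z
    using c[of z] that by (auto simp: exp_minus field_simps)
  then show ?thesis by (rule that)
qed

lemma norm_one_minus_cnj_tau: "cmod (1 - cnj z * \<tau>) = cmod (\<tau> - z)"
proof -
  have "(cmod (1 - cnj z * \<tau>))\<^sup>2 = (cmod (\<tau> - z))\<^sup>2"
    using norm_one_minus_cnj_mult_sq[of z \<tau>] by (simp add: norm_tau norm_minus_commute)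
  then show ?thesis by (simp add: power2_eq_iff_nonneg)
qed

text \<open>Wolff's lemma: horodisks at the Denjoy-Wolff point are invariant. Apply Schwarz-Pick to \<open>z\<close> and
  the points \<open>\<phi> (n t) 0\<close> of an orbit, which tend to \<open>\<tau>\<close>. Since their moduli are less than \<open>1\<close>
  and tend to \<open>1\<close>, infinitely many steps do not move away from the circle; along these the factors
  \<open>1 - |.|\<^sup>2\<close> of the orbit points can be cancelled, and the limit is the claim.\<close>

lemma Re_cayley_flow:
  assumes t: "0 \<le> t" and z: "cmod z < 1"
  shows "Re (cayley \<tau> z) \<le> Re (cayley \<tau> (\<phi> t z))"
proof (cases "t = 0")
  case True
  then show ?thesis using flow_0[OF z] by simp
next
  case False
  then have t0: "t > 0" using t by simp
  let ?z = "\<lambda>n. \<phi> (real n * t) 0" and ?w = "\<phi> t z"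
  have w: "cmod ?w < 1" using flow_in_disk[OF t z] .
  have z1: "cmod (?z n) < 1" for n using t by (intro flow_in_disk) auto
  have zS: "?z (Suc n) = \<phi> t (?z n)" for n
    using flow_add[of t "real n * t" 0] t by (simp add: algebra_simps)
  have lim: "?z \<longlonglongrightarrow> \<tau>" using t0 by (intro orbit_tendsto) auto
  have freq: "\<exists>\<^sub>F n in sequentially. cmod (?z n) \<le> cmod (?z (Suc n))"
  proof (rule ccontr)
    assume "\<not> (\<exists>\<^sub>F n in sequentially. cmod (?z n) \<le> cmod (?z (Suc n)))"
    then obtain N where N: "\<And>n. n \<ge> N \<Longrightarrow> cmod (?z (Suc n)) < cmod (?z n)"
      by (auto simp: not_frequently eventually_sequentially not_le)
    have "cmod (?z n) \<le> cmod (?z N)" if "n \<ge> N" for n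
      using that by (induction n rule: dec_induct) (use N in \<open>auto intro: order_trans less_imp_le\<close>)
    then have "cmod \<tau> \<le> cmod (?z N)"
      by (intro tendsto_upperbound[OF tendsto_norm[OF lim]]) (auto simp: eventually_sequentially)
    then show False using z1[of N] norm_tau by simp
  qed
  let ?A = "\<lambda>n. (cmod (1 - cnj ?w * ?z (Suc n)))\<^sup>2 / (1 - (cmod ?w)\<^sup>2)"
  let ?B = "\<lambda>n. (cmod (1 - cnj z * ?z n))\<^sup>2 / (1 - (cmod z)\<^sup>2)"
  have AB: "?A n \<le> ?B n" if "cmod (?z n) \<le> cmod (?z (Suc n))" for n
  proof -
    let ?s = "1 - (cmod (?z n))\<^sup>2" and ?s' = "1 - (cmod (?z (Suc n)))\<^sup>2"
    have s: "0 < ?s'" "?s' \<le> ?s"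
      using that one_minus_norm_sq_pos[OF z1[of "Suc n"]] by (auto intro!: power_mono simp del: of_nat_Suc)
    have A0: "0 \<le> ?A n" using one_minus_norm_sq_pos[OF w] by simp
    have "pick_ratio ?w (?z (Suc n)) \<le> pick_ratio z (?z n)"
      unfolding zS by (intro Schwarz_Pick flow_holomorphic flow_image t z z1)
    then have "?A n / ?s' \<le> ?B n / ?s"
      by (simp add: pick_ratio_def)
    moreover have "?A n / ?s \<le> ?A n / ?s'"
      using s A0 mult_pos_pos[of ?s ?s'] by (intro divide_left_mono) linarith+
    ultimately have "?A n / ?s \<le> ?B n / ?s" by linarith
    then show ?thesis using s by (simp only: divide_le_cancel)
  qed
  have "(\<lambda>n. ?B n - ?A n) \<longlonglongrightarrow> (cmod (1 - cnj z * \<tau>))\<^sup>2 / (1 - (cmod z)\<^sup>2) - (cmod (1 - cnj ?w * \<tau>))\<^sup>2 / (1 - (cmod ?w)\<^sup>2)"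
    using one_minus_norm_sq_pos[OF z] one_minus_norm_sq_pos[OF w]
    by (intro tendsto_intros lim LIMSEQ_Suc[OF lim]) auto
  also have "(cmod (1 - cnj z * \<tau>))\<^sup>2 / (1 - (cmod z)\<^sup>2) - (cmod (1 - cnj ?w * \<tau>))\<^sup>2 / (1 - (cmod ?w)\<^sup>2)
      = 1 / Re (cayley \<tau> z) - 1 / Re (cayley \<tau> ?w)"
    by (simp add: Re_cayley norm_tau norm_one_minus_cnj_tau)
  finally have lim2: "(\<lambda>n. ?B n - ?A n) \<longlonglongrightarrow> 1 / Re (cayley \<tau> z) - 1 / Re (cayley \<tau> ?w)" .
  have "0 \<le> 1 / Re (cayley \<tau> z) - 1 / Re (cayley \<tau> ?w)"
  proof (rule ccontr)
    assume "\<not> ?thesis"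
    then have "\<forall>\<^sub>F n in sequentially. ?B n - ?A n < 0"
      by (intro order_tendstoD(2)[OF lim2]) simp
    then have "\<forall>\<^sub>F n in sequentially. \<not> cmod (?z n) \<le> cmod (?z (Suc n))"
    proof eventually_elim
      case (elim n)
      then show ?case using AB[of n] by linarith
    qed
    then show False using freq by (simp add: frequently_def)
  qed
  then show ?thesis
    using Re_cayley_pos[OF norm_tau z] Re_cayley_pos[OF norm_tau w] by (simp add: field_simps)
qed

text \<open>By \<open>Re_cayley_flow\<close> the velocity of the flow in the coordinate \<open>cayley \<tau>\<close> has nonnegative real
  part, hence so does its reciprocal \<open>Q\<close>. A function of nonnegative real part grows at
  most like \<open>1 / (1 - |z|)\<close>, by Schwarz-Pick against the point \<open>0\<close>.\<close>

lemma deriv_h_bound: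
  obtains K where "0 \<le> K" "\<And>z. cmod z < 1 \<Longrightarrow> cmod (deriv h z) \<le> K / ((1 - cmod z) * (cmod (\<tau> - z))\<^sup>2)"
proof -
  define Q where "Q z = (\<tau> - z)\<^sup>2 * deriv h z / (2 * \<tau>)" for z
  have t0: "\<tau> \<noteq> 0" using norm_tau by auto
  have Qhol: "Q holomorphic_on unit_disk"
    unfolding Q_def using t0 by (intro holomorphic_intros holomorphic_deriv h_holomorphic) auto
  have Qpos: "0 \<le> Re (Q z)" if z: "cmod z < 1" for z
  proof -
    have lim: "((\<lambda>t. Re ((cayley \<tau> (\<phi> t z) - cayley \<tau> z) / of_real t)) \<longlongrightarrow> Re (deriv (cayley \<tau>) z / deriv h z)) (at_right 0)"
      by (intro tendsto_Re deriv_along_flow cayley_holomorphic norm_tau z)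
    have "0 \<le> Re (deriv (cayley \<tau>) z / deriv h z)"
    proof (rule tendsto_lowerbound[OF lim])
      show "\<forall>\<^sub>F t in at_right 0. 0 \<le> Re ((cayley \<tau> (\<phi> t z) - cayley \<tau> z) / of_real t)"
        using eventually_at_right_less[of "0::real"]
        by eventually_elim (use Re_cayley_flow[OF _ z] in auto)
    qed simp
    moreover have "deriv (cayley \<tau>) z / deriv h z = inverse (Q z)"
      using DERIV_imp_deriv[OF cayley_deriv[OF norm_tau z]] by (simp add: Q_def)
    ultimately have "0 \<le> Re (Q z) / (cmod (Q z))\<^sup>2"
      by (simp add: inverse_complex.simps cmod_power2)
    then show ?thesis
      using cayley_denom[OF norm_tau z] deriv_h_nonzero[OF z] t0 by (simp add: zero_le_divide_iff Q_def)
  qed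
  have bound: "cmod (Q z) \<le> 5 * cmod (Q 0) / (1 - cmod z)" if z: "cmod z < 1" for z
  proof -
    let ?X = "cmod (Q z + cnj (Q 0))" and ?r = "1 - cmod z"
    have r: "0 < ?r" "?r \<le> 1" "?r \<le> 1 - (cmod z)\<^sup>2"
      using z by (auto simp: power2_eq_square mult_left_le)
    have "?X\<^sup>2 \<le> 4 * Re (Q z) * Re (Q 0) * (1 / (1 - (cmod z)\<^sup>2))"
      using Schwarz_Pick_halfplane[OF Qhol Qpos z, of 0] by (simp add: pick_ratio_def)
    also have "\<dots> \<le> 4 * ?X * cmod (Q 0) * (1 / ?r)"
    proof (intro mult_mono)
      show "Re (Q z) \<le> ?X"
        using complex_Re_le_cmod[of "Q z + cnj (Q 0)"] Qpos[of 0] by simp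
    qed (use r Qpos[OF z] Qpos[of 0] in \<open>auto intro!: divide_left_mono complex_Re_le_cmod\<close>)
    finally have "?X * ?X \<le> ?X * (4 * cmod (Q 0) / ?r)"
      by (simp add: power2_eq_square mult_ac)
    then have X: "?X \<le> 4 * cmod (Q 0) / ?r"
    proof (cases "?X = 0")
      case True
      then show ?thesis using r by simp
    next
      case False
      then have "0 < ?X" using norm_ge_zero[of "Q z + cnj (Q 0)"] by linarith
      then show ?thesis using \<open>?X * ?X \<le> _\<close> by (simp only: mult_le_cancel_left_pos)
    qed
    have "cmod (Q 0) \<le> cmod (Q 0) / ?r" using r by (simp add: pos_le_divide_eq mult_left_le)
    moreover have "cmod (Q z) \<le> ?X + cmod (Q 0)"
      using norm_triangle_ineq4[of "Q z + cnj (Q 0)" "cnj (Q 0)"] by simp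
    ultimately show ?thesis using X by (simp add: add_divide_distrib[symmetric])
  qed
  show ?thesis
  proof
    show "0 \<le> 10 * cmod (Q 0)" by simp
    fix z :: complex assume z: "cmod z < 1"
    have T: "0 < (cmod (\<tau> - z))\<^sup>2" using cayley_denom[OF norm_tau z] by simp
    have "cmod (deriv h z) * (cmod (\<tau> - z))\<^sup>2 = 2 * cmod (Q z)"
      by (simp add: Q_def norm_mult norm_divide norm_power norm_tau)
    also have "\<dots> \<le> 10 * cmod (Q 0) / (1 - cmod z)" using bound[OF z] by simp
    finally show "cmod (deriv h z) \<le> 10 * cmod (Q 0) / ((1 - cmod z) * (cmod (\<tau> - z))\<^sup>2)"
      using T by (simp add: pos_le_divide_eq flip: divide_divide_eq_left)
  qed
qed

end

section \<open>Eigenfunctions along orbits\<close>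

text \<open>In the cases of geometric growth, this is what contradicts \<open>dirichlet_pick_step\<close>.\<close>

lemma differences_of_geometric_growth:
  fixes x :: "nat \<Rightarrow> complex"
  assumes growth: "\<forall>\<^sub>F n in sequentially. k * cmod (x n) \<le> cmod (x (Suc n))" and k: "1 < k"
    and nz: "\<And>n. x n \<noteq> 0"
  shows "\<not> (\<lambda>n. x n - x (Suc n)) \<longlonglongrightarrow> 0"
proof
  assume lim: "(\<lambda>n. x n - x (Suc n)) \<longlonglongrightarrow> 0"
  obtain N where N: "\<And>n. n \<ge> N \<Longrightarrow> k * cmod (x n) \<le> cmod (x (Suc n))"
    using growth by (auto simp: eventually_sequentially)
  have mono: "cmod (x N) \<le> cmod (x n)" if "n \<ge> N" for n
    using that
  proof (induction n rule: dec_induct)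
    case (step n)
    have "1 * cmod (x n) \<le> k * cmod (x n)" using k by (intro mult_right_mono) auto
    then show ?case using step N[of n] by simp
  qed simp
  have "(k - 1) * cmod (x N) \<le> cmod (x n - x (Suc n))" if "n \<ge> N" for n
  proof -
    have "(k - 1) * cmod (x N) \<le> (k - 1) * cmod (x n)" using mono[OF that] k by (intro mult_left_mono) auto
    also have "\<dots> \<le> cmod (x (Suc n)) - cmod (x n)" using N[OF that] by (simp add: algebra_simps)
    also have "\<dots> \<le> cmod (x n - x (Suc n))" using norm_triangle_ineq3[of "x (Suc n)" "x n"] by (simp add: norm_minus_commute)
    finally show ?thesis .
  qed
  then have "(k - 1) * cmod (x N) \<le> cmod 0"
    by (intro tendsto_lowerbound[OF tendsto_norm[OF lim]]) (auto simp: eventually_sequentially)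
  then show False using k nz[of N] by (simp add: mult_le_0_iff)
qed

lemma dirichlet_pick_step:
  assumes f: "f \<in> dirichlet_space" and z: "\<And>n. cmod (z n) < 1"
    and lim: "(\<lambda>n. cmod (z n)) \<longlonglongrightarrow> 1" and M: "\<And>n. pick_ratio (z n) (z (Suc n)) \<le> M"
  shows "(\<lambda>n. f (z n) - f (z (Suc n))) \<longlonglongrightarrow> 0"
  using z by (intro dirichlet_diff_tendsto_0[OF f _ _ lim, of _ "4 * M"] pick_ratio_imp_close M) auto

text \<open>Every eigenfunction for a nonzero eigenvalue gives an instance of this locale; under the
  hypotheses of each case of the theorem the locale is shown to be inconsistent.\<close>

locale dirichlet_eigenfunction = koenigs_semigroup +
  fixes f :: "complex \<Rightarrow> complex" and \<mu> c :: complex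
  assumes f_dirichlet: "f \<in> dirichlet_space"
    and f_form: "\<And>z. cmod z < 1 \<Longrightarrow> f z = c * exp (\<mu> * h z)"
    and c_nonzero: "c \<noteq> 0" and mu_nonzero: "\<mu> \<noteq> 0"
begin

lemma f_nonzero: "cmod z < 1 \<Longrightarrow> f z \<noteq> 0"
  using f_form c_nonzero by simp

lemma f_flow: "\<lbrakk>0 \<le> t; cmod z < 1\<rbrakk> \<Longrightarrow> f (\<phi> t z) = exp (\<mu> * of_real t) * f z"
  using f_form flow_in_disk[of t z] h_flow[of t z] by (simp add: distrib_left exp_add)

text \<open>If \<open>Re \<mu> \<ge> 0\<close>, then \<open>f\<close> does not decrease in modulus along the forward orbit of \<open>0\<close> and is
  multiplied at each step by the same number \<open>exp (\<mu> t) \<noteq> 1\<close>, so its differences along the orbit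
  are bounded below.\<close>

lemma Re_mu_neg: "Re \<mu> < 0"
proof (rule ccontr)
  assume "\<not> Re \<mu> < 0"
  then have Re: "0 \<le> Re \<mu>" by simp
  \<comment> \<open>Small enough to make \<open>|\<mu> t| < 1\<close>, below the period \<open>2 \<pi>\<close> of the exponential.\<close>
  define t where "t = 1 / (1 + cmod \<mu>)"
  have t: "t > 0" by (simp add: t_def add_pos_nonneg)
  have "0 < 1 + cmod \<mu>" by (simp add: add_pos_nonneg)
  then have "cmod \<mu> * t < 1" by (simp add: t_def)
  then have "cmod (\<mu> * of_real t) < 1" using t by (simp add: norm_mult)
  have e1: "exp (\<mu> * of_real t) \<noteq> 1"
  proof
    assume "exp (\<mu> * of_real t) = 1"
    then obtain n :: int where n: "Re (\<mu> * of_real t) = 0" "Im (\<mu> * of_real t) = of_int (2 * n) * pi"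
      by (auto simp: exp_eq_1)
    have "\<bar>of_int (2 * n) * pi\<bar> < 1"
      using abs_Im_le_cmod[of "\<mu> * of_real t"] n(2) \<open>cmod (\<mu> * of_real t) < 1\<close> by linarith
    moreover have "1 \<le> \<bar>of_int (2 * n) * pi\<bar>" if "n \<noteq> 0"
    proof -
      have "1 * 1 \<le> \<bar>of_int (2 * n)\<bar> * pi"
        using that pi_ge_two by (intro mult_mono) auto
      then show ?thesis by (simp add: abs_mult)
    qed
    ultimately have "n = 0" by force
    then have "\<mu> * of_real t = 0" using n by (simp add: complex_eq_iff)
    then show False using mu_nonzero t by simp
  qed
  let ?z = "\<lambda>n. \<phi> (real n * t) 0"
  have z: "cmod (?z n) < 1" for n using t by (intro flow_in_disk) auto
  have zS: "?z (Suc n) = \<phi> t (?z n)" for n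
    using flow_add[of t "real n * t" 0] t by (simp add: algebra_simps)
  have lim: "(\<lambda>n. cmod (?z n)) \<longlonglongrightarrow> 1"
    using tendsto_norm[OF orbit_tendsto[of t 0]] t norm_tau by simp
  have "pick_ratio (?z n) (?z (Suc n)) \<le> pick_ratio (?z 0) (?z (Suc 0))" for n
  proof (induction n)
    case (Suc n)
    have "pick_ratio (\<phi> t (?z n)) (\<phi> t (?z (Suc n))) \<le> pick_ratio (?z n) (?z (Suc n))"
      using t by (intro Schwarz_Pick flow_holomorphic flow_image z) auto
    then show ?case using Suc unfolding zS[of "Suc n"] zS[of n] by linarith
  qed simp
  then have "(\<lambda>n. f (?z n) - f (?z (Suc n))) \<longlonglongrightarrow> 0"
    by (rule dirichlet_pick_step[OF f_dirichlet z lim])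
  then have lim0: "(\<lambda>n. cmod (f (?z n) - f (?z (Suc n)))) \<longlonglongrightarrow> 0"
    by (rule tendsto_norm_zero)
  have "cmod (f 0) * cmod (1 - exp (\<mu> * of_real t)) \<le> cmod (f (?z n) - f (?z (Suc n)))" for n
  proof -
    have "f (?z n) - f (?z (Suc n)) = f (?z n) * (1 - exp (\<mu> * of_real t))"
      unfolding zS using f_flow[of t "?z n"] z[of n] t by (simp add: algebra_simps)
    moreover have "cmod (f 0) \<le> cmod (f (?z n))"
      using f_flow[of "real n * t" 0] t Re by (simp add: norm_mult mult_left_le_one_le mult_le_cancel_right1)
    ultimately show ?thesis by (simp add: norm_mult mult_right_mono)
  qed
  then have "cmod (f 0) * cmod (1 - exp (\<mu> * of_real t)) \<le> 0"
    by (intro tendsto_lowerbound[OF lim0]) auto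
  then show False using f_nonzero[of 0] e1 by (simp add: mult_le_0_iff)
qed

text \<open>The backward orbit of \<open>0\<close> under the inverse of \<open>\<phi> 1\<close> has steps of nonincreasing hyperbolic length,
  and \<open>|f|\<close> grows along it by the factor \<open>exp (- Re \<mu>) > 1\<close>.\<close>

lemma flow_not_automorphism: "\<not> disk_automorphism (\<phi> 1)"
proof
  assume aut: "disk_automorphism (\<phi> 1)"
  define g where "g = inv_into unit_disk (\<phi> 1)"
  have bij: "bij_betw (\<phi> 1) unit_disk unit_disk" and ghol: "g holomorphic_on unit_disk"
    using aut by (auto simp: disk_automorphism_def g_def)
  have gim: "g ` unit_disk \<subseteq> unit_disk"
    unfolding g_def using bij by (metis bij_betw_def bij_betw_inv_into subset_refl)
  have fg: "\<phi> 1 (g w) = w" if "cmod w < 1" for w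
    unfolding g_def using bij that by (simp add: bij_betw_inv_into_right)
  define z where "z n = (g ^^ n) 0" for n
  have zS: "z (Suc n) = g (z n)" for n by (simp add: z_def)
  have z: "cmod (z n) < 1" for n
    by (induction n) (use gim in \<open>auto simp: z_def image_subset_iff\<close>)
  have fz: "cmod (f (z (Suc n))) = exp (- Re \<mu>) * cmod (f (z n))" for n
  proof -
    have "f (z n) = exp \<mu> * f (z (Suc n))"
      using f_flow[of 1 "z (Suc n)"] fg[OF z[of n]] z[of "Suc n"] by (simp add: zS)
    then show ?thesis by (simp add: norm_mult exp_minus field_simps)
  qed
  have fzn: "cmod (f (z n)) = exp (- Re \<mu>) ^ n * cmod (f 0)" for n
    by (induction n) (simp_all add: fz, simp add: z_def)
  have e1: "1 < exp (- Re \<mu>)" using Re_mu_neg by simp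
  have lim: "(\<lambda>n. cmod (z n)) \<longlonglongrightarrow> 1"
  proof (rule order_tendstoI)
    \<comment> \<open>The backward orbit leaves every compact subset of the disk because \<open>f\<close> is unbounded on it.\<close>
    fix r :: real assume r: "r < 1"
    have "continuous_on (cball 0 r) f"
      using f_dirichlet r by (auto simp: dirichlet_space_def intro!: holomorphic_on_imp_continuous_on elim!: holomorphic_on_subset)
    then have "bounded (f ` cball 0 r)"
      by (intro compact_imp_bounded compact_continuous_image) auto
    then obtain B where B: "\<And>w. cmod w \<le> r \<Longrightarrow> cmod (f w) \<le> B"
      unfolding bounded_iff by (metis image_eqI mem_cball_0)
    obtain N where N: "B / cmod (f 0) < exp (- Re \<mu>) ^ N"
      using real_arch_pow[OF e1] by blast
    have "\<forall>\<^sub>F n in sequentially. B < cmod (f (z n))"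
      using eventually_ge_at_top[of N]
    proof eventually_elim
      case (elim n)
      have "B < exp (- Re \<mu>) ^ N * cmod (f 0)"
        using N f_nonzero[of 0] by (simp add: divide_less_eq)
      also have "\<dots> \<le> exp (- Re \<mu>) ^ n * cmod (f 0)"
        using elim e1 by (intro mult_right_mono power_increasing) auto
      finally show ?case by (simp only: fzn)
    qed
    then show "\<forall>\<^sub>F n in sequentially. r < cmod (z n)"
      by (rule eventually_mono) (use B in \<open>force simp: not_le[symmetric]\<close>)
  qed (use z in \<open>auto intro: always_eventually order_less_trans\<close>)
  have "pick_ratio (z n) (z (Suc n)) \<le> pick_ratio (z 0) (z (Suc 0))" for n
  proof (induction n)
    case (Suc n)
    have "pick_ratio (g (z n)) (g (z (Suc n))) \<le> pick_ratio (z n) (z (Suc n))"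
      by (intro Schwarz_Pick ghol gim z)
    then show ?case using Suc unfolding zS[of "Suc n"] zS[of n] by linarith
  qed simp
  then have "(\<lambda>n. f (z n) - f (z (Suc n))) \<longlonglongrightarrow> 0"
    by (rule dirichlet_pick_step[OF f_dirichlet z lim])
  then show False
    using differences_of_geometric_growth[of "exp (- Re \<mu>)" "\<lambda>n. f (z n)"] fz e1 f_nonzero[OF z] by simp
qed

end

section \<open>Repelling fixed points\<close>

lemma norm_radial:
  assumes "cmod \<sigma> = 1" "0 \<le> r" "r \<le> 1"
  shows "cmod (of_real (1 - r) * \<sigma>) = 1 - r" "cmod (\<sigma> - of_real (1 - r) * \<sigma>) = r"
proof -
  show "cmod (of_real (1 - r) * \<sigma>) = 1 - r"
    using assms unfolding norm_mult norm_of_real by simp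
  have "\<sigma> - of_real (1 - r) * \<sigma> = of_real r * \<sigma>" by (simp add: algebra_simps)
  then have "cmod (\<sigma> - of_real (1 - r) * \<sigma>) = \<bar>r\<bar> * cmod \<sigma>" by (simp only: norm_mult norm_of_real)
  then show "cmod (\<sigma> - of_real (1 - r) * \<sigma>) = r"
    using assms by simp
qed

lemma has_angular_limit_radial:
  assumes lim: "has_angular_limit g \<sigma> l" and \<sigma>: "cmod \<sigma> = 1"
    and r: "\<And>n. 0 < r n" "\<And>n. r n \<le> 1" "r \<longlonglongrightarrow> 0"
  shows "(\<lambda>n. g (of_real (1 - r n) * \<sigma>)) \<longlonglongrightarrow> l"
proof -
  let ?z = "\<lambda>n. of_real (1 - r n) * \<sigma>"
  have nz: "cmod (?z n) = 1 - r n" "cmod (\<sigma> - ?z n) = r n" for n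
    using norm_radial[OF \<sigma>, of "r n"] r(1,2)[of n] by simp_all
  have "?z n \<in> stolz_region \<sigma> 2" for n
    unfolding stolz_region_def mem_Collect_eq mem_ball_0 nz using r(1)[of n] by simp
  moreover have "?z n \<noteq> \<sigma>" for n
    using nz(2)[of n] r(1)[of n] by (metis diff_self less_irrefl norm_zero)
  moreover have "?z \<longlonglongrightarrow> of_real (1 - 0) * \<sigma>"
    by (intro tendsto_intros r(3))
  ultimately have "filterlim ?z (at \<sigma> within stolz_region \<sigma> 2) sequentially"
    by (auto simp: filterlim_at)
  moreover have "(g \<longlongrightarrow> l) (at \<sigma> within stolz_region \<sigma> 2)"
    using lim by (simp add: has_angular_limit_def)
  ultimately show ?thesis by (rule filterlim_compose[rotated])
qed


lemma has_angular_derivative_radial: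
  assumes fp: "has_angular_limit g \<sigma> \<sigma>" and der: "has_angular_derivative g \<sigma> d" and \<sigma>: "cmod \<sigma> = 1"
    and r: "\<And>n. 0 < r n" "\<And>n. r n \<le> 1" "r \<longlonglongrightarrow> 0"
  shows "(\<lambda>n. (\<sigma> - g (of_real (1 - r n) * \<sigma>)) / (of_real (r n) * \<sigma>)) \<longlonglongrightarrow> d"
proof -
  let ?z = "\<lambda>n. of_real (1 - r n) * \<sigma>"
  obtain \<omega> where \<omega>: "has_angular_limit g \<sigma> \<omega>" "has_angular_limit (\<lambda>z. (g z - \<omega>) / (z - \<sigma>)) \<sigma> d"
    using der by (auto simp: has_angular_derivative_def)
  have "\<omega> = \<sigma>"
    using has_angular_limit_radial[OF fp \<sigma> r] has_angular_limit_radial[OF \<omega>(1) \<sigma> r] by (rule LIMSEQ_unique[rotated])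
  then have "(\<lambda>n. (g (?z n) - \<sigma>) / (?z n - \<sigma>)) \<longlonglongrightarrow> d"
    using has_angular_limit_radial[OF \<omega>(2) \<sigma> r] by simp
  moreover have "(g (?z n) - \<sigma>) / (?z n - \<sigma>) = (\<sigma> - g (?z n)) / (of_real (r n) * \<sigma>)" for n
  proof -
    have "?z n - \<sigma> = - (of_real (r n) * \<sigma>)" by (simp add: algebra_simps)
    then show ?thesis by (simp only: minus_divide_right[symmetric] divide_minus_left[symmetric] minus_diff_eq)
  qed
  ultimately show ?thesis by simp
qed

context koenigs_semigroup
begin

text \<open>Invariance of horodisks forces an angular derivative of at most \<open>1\<close> at \<open>\<tau>\<close>: on the radius at
  distance \<open>r\<close> from \<open>\<tau>\<close> one has \<open>Re (cayley \<tau> z) = (2 - r) / r\<close>, whereas the image point, at distance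
  about \<open>a r\<close> from \<open>\<tau>\<close>, has \<open>Re (cayley \<tau> _) \<le> 2 / (a r)\<close> approximately.\<close>

lemma repelling_neq_tau:
  assumes "repelling_fixed_point \<phi> \<sigma>"
  shows "\<sigma> \<noteq> \<tau>"
proof
  assume st: "\<sigma> = \<tau>"
  obtain a :: real where a: "1 < a" "has_angular_limit (\<phi> 1) \<tau> \<tau>" "has_angular_derivative (\<phi> 1) \<tau> (of_real a)"
    using assms st unfolding repelling_fixed_point_def by (metis zero_less_one)
  define r where "r n = 1 / real (Suc n)" for n
  have r: "0 < r n" "r n \<le> 1" "r \<longlonglongrightarrow> 0" for n
    using LIMSEQ_inverse_real_of_nat by (simp_all add: r_def[abs_def] inverse_eq_divide)
  let ?z = "\<lambda>n. of_real (1 - r n) * \<tau>"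
  let ?D = "\<lambda>n. (\<tau> - \<phi> 1 (?z n)) / (of_real (r n) * \<tau>)"
  have lim: "?D \<longlonglongrightarrow> of_real a"
    by (rule has_angular_derivative_radial[OF a(2,3) norm_tau r])
  have "(2 - r n) * cmod (?D n) \<le> 2" for n
  proof -
    have zn: "cmod (?z n) = 1 - r n" "cmod (\<tau> - ?z n) = r n"
      using norm_radial[OF norm_tau, of "r n"] r(1,2)[of n] by simp_all
    then have z1: "cmod (?z n) < 1" using r(1,2)[of n] by simp
    let ?w = "\<phi> 1 (?z n)"
    have w1: "cmod ?w < 1" using z1 by (intro flow_in_disk) auto
    have D: "cmod (?D n) = cmod (\<tau> - ?w) / r n" using r(1,2)[of n] norm_tau by (simp add: norm_divide norm_mult)
    have tw: "0 < cmod (\<tau> - ?w)" using cayley_denom[OF norm_tau w1] by simp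
    have "(2 - r n) / r n = Re (cayley \<tau> (?z n))"
      using r(1)[of n] unfolding Re_cayley[OF norm_tau] zn by (simp add: power2_eq_square field_simps)
    also have "\<dots> \<le> Re (cayley \<tau> ?w)" using z1 by (intro Re_cayley_flow) auto
    also have "\<dots> = (1 - cmod ?w) * (1 + cmod ?w) / (cmod (\<tau> - ?w))\<^sup>2"
      by (simp add: Re_cayley norm_tau power2_eq_square algebra_simps)
    also have "\<dots> \<le> cmod (\<tau> - ?w) * 2 / (cmod (\<tau> - ?w))\<^sup>2"
      using w1 norm_triangle_ineq2[of \<tau> ?w] norm_tau by (intro divide_right_mono mult_mono) auto
    also have "\<dots> = 2 / cmod (\<tau> - ?w)" using tw by (simp add: power2_eq_square)
    finally show ?thesis
      unfolding D using tw r(1)[of n] by (simp add: field_simps)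
  qed
  moreover have "(\<lambda>n. (2 - r n) * cmod (?D n)) \<longlonglongrightarrow> (2 - 0) * cmod (of_real a)"
    by (intro tendsto_intros r(3) lim)
  ultimately have "(2 - 0) * cmod (of_real a) \<le> 2"
    by (intro tendsto_upperbound) auto
  then show False using a(1) by simp
qed

text \<open>With \<open>z n = (1 - a^(-n)) \<sigma>\<close>, the angular derivative shows that \<open>\<phi> 1\<close> takes \<open>z (n + 1)\<close> to a point at
  distance \<open>o(1 - |z n|)\<close> from \<open>z n\<close>. Near \<open>\<sigma> \<noteq> \<tau>\<close> the derivative of \<open>h\<close> is \<open>O(1 / (1 - |z|))\<close>, so
  \<open>h (z (n + 1)) + 1\<close> and \<open>h (z n)\<close> differ by \<open>o(1)\<close>.\<close>

lemma koenigs_along_repelling_radius: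
  assumes rep: "repelling_fixed_point \<phi> \<sigma>"
  obtains a :: real where "1 < a"
    "(\<lambda>n. h (of_real (1 - (1/a) ^ Suc n) * \<sigma>) - h (of_real (1 - (1/a) ^ n) * \<sigma>)) \<longlonglongrightarrow> - 1"
proof -
  have \<sigma>: "cmod \<sigma> = 1" using rep by (simp add: repelling_fixed_point_def)
  obtain a :: real where a: "1 < a" "has_angular_limit (\<phi> 1) \<sigma> \<sigma>" "has_angular_derivative (\<phi> 1) \<sigma> (of_real a)"
    using rep unfolding repelling_fixed_point_def by (metis zero_less_one)
  define r where "r n = (1/a) ^ n" for n
  have r: "0 < r n" "r n \<le> 1" "r \<longlonglongrightarrow> 0" for n
    using a(1) by (auto simp: r_def[abs_def] intro!: LIMSEQ_realpow_zero power_le_one)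
  have rS: "r (Suc n) = r n / a" for n by (simp add: r_def)
  define z where "z n = of_real (1 - r n) * \<sigma>" for n
  have zn: "cmod (z n) = 1 - r n" "cmod (\<sigma> - z n) = r n" for n
    using norm_radial[OF \<sigma>, of "r n"] r(1,2)[of n] by (simp_all only: z_def less_imp_le)
  have z1: "cmod (z n) < 1" for n using zn(1)[of n] r(1)[of n] by simp
  define D where "D n = (\<sigma> - \<phi> 1 (z n)) / (of_real (r n) * \<sigma>)" for n
  define y where "y n = \<phi> 1 (z (Suc n))" for n
  have y1: "cmod (y n) < 1" for n unfolding y_def by (intro flow_in_disk z1) simp
  have "D \<longlonglongrightarrow> of_real a"
    unfolding D_def z_def by (rule has_angular_derivative_radial[OF a(2,3) \<sigma> r])
  then have Dlim: "(\<lambda>n. D (Suc n)) \<longlonglongrightarrow> of_real a" by (rule LIMSEQ_Suc)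
  define e where "e n = cmod (1 - D (Suc n) / of_real a)" for n
  have "(\<lambda>n. cmod (1 - D (Suc n) / of_real a)) \<longlonglongrightarrow> cmod (1 - of_real a / of_real a)"
    using a(1) by (intro tendsto_intros Dlim) auto
  then have elim0: "e \<longlonglongrightarrow> 0" using a(1) by (simp add: e_def[abs_def])
  have yz: "cmod (y n - z n) = r n * e n" for n
  proof -
    have "\<sigma> - y n = of_real (r (Suc n)) * \<sigma> * D (Suc n)"
      using r(1)[of "Suc n"] \<sigma> by (auto simp: D_def y_def)
    then have "y n - z n = of_real (r n) * \<sigma> * (1 - D (Suc n) / of_real a)"
      by (simp add: z_def rS algebra_simps)
    then show ?thesis using r(1)[of n] \<sigma> by (simp add: norm_mult e_def)
  qed
  \<comment> \<open>Eventually the segment from \<open>z n\<close> to \<open>y n\<close> stays at distance at least \<open>2 \<delta>\<close> from \<open>\<tau>\<close>.\<close>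
  define \<delta> where "\<delta> = cmod (\<tau> - \<sigma>) / 4"
  have \<delta>: "0 < \<delta>" using repelling_neq_tau[OF rep] by (simp add: \<delta>_def)
  obtain K where K: "0 \<le> K" "\<And>z. cmod z < 1 \<Longrightarrow> cmod (deriv h z) \<le> K / ((1 - cmod z) * (cmod (\<tau> - z))\<^sup>2)"
    using deriv_h_bound by blast
  have ev: "\<forall>\<^sub>F n in sequentially. cmod (h (y n) - h (z n)) \<le> K / (2 * \<delta>\<^sup>2) * e n"
  proof -
    have "\<forall>\<^sub>F n in sequentially. e n < 1/2" "\<forall>\<^sub>F n in sequentially. r n < \<delta>"
      by (intro order_tendstoD(2)[OF elim0] order_tendstoD(2)[OF r(3)] \<delta>; simp)+
    then show ?thesis
    proof eventually_elim
      case (elim n)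
      have half: "r n * e n \<le> r n / 2"
        using elim r(1)[of n] by simp
      have d: "cmod (deriv h u) \<le> K / (2 * \<delta>\<^sup>2 * r n)" if u: "u \<in> closed_segment (z n) (y n)" for u
      proof -
        have uz: "cmod (u - z n) \<le> r n / 2"
          using segment_bound(1)[OF u] yz[of n] half by (simp add: norm_minus_commute)
        have "cmod u \<le> cmod (u - z n) + cmod (z n)" using norm_triangle_sub[of u "z n"] by simp
        then have lo: "r n / 2 \<le> 1 - cmod u" using uz zn(1)[of n] by simp
        have "cmod (\<tau> - \<sigma>) \<le> cmod (\<tau> - u) + cmod (u - z n) + cmod (\<sigma> - z n)"
          using norm_triangle_ineq[of "\<tau> - u" "u - z n"] norm_triangle_ineq4[of "\<tau> - z n" "\<sigma> - z n"] by simp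
        then have far: "2 * \<delta> \<le> cmod (\<tau> - u)"
          using zn(2)[of n] uz elim(2) r(1)[of n] \<delta> by (simp add: \<delta>_def)
        have "2 * \<delta>\<^sup>2 * r n = (r n / 2) * (2 * \<delta>)\<^sup>2" by (simp add: power2_eq_square)
        also have "\<dots> \<le> (1 - cmod u) * (cmod (\<tau> - u))\<^sup>2"
          using lo far \<delta> r(1)[of n] by (intro mult_mono power_mono) auto
        finally have "K / ((1 - cmod u) * (cmod (\<tau> - u))\<^sup>2) \<le> K / (2 * \<delta>\<^sup>2 * r n)"
          using K(1) \<delta> r(1)[of n] lo far by (intro divide_left_mono mult_pos_pos zero_less_power) auto
        moreover have "cmod u < 1" using lo r(1)[of n] by simp
        ultimately show ?thesis using K(2)[of u] by simp
      qed
      have seg: "closed_segment (z n) (y n) \<subseteq> unit_disk"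
        using z1[of n] y1[of n] by (simp add: closed_segment_subset)
      have "cmod (h (y n) - h (z n)) \<le> K / (2 * \<delta>\<^sup>2 * r n) * cmod (y n - z n)"
      proof (rule field_differentiable_bound[where S="closed_segment (z n) (y n)" and f'="deriv h"])
        fix u assume u: "u \<in> closed_segment (z n) (y n)"
        then have "u \<in> unit_disk" using seg by auto
        then show "(h has_field_derivative deriv h u) (at u within closed_segment (z n) (y n))"
          by (rule has_field_derivative_at_within[OF holomorphic_derivI[OF h_holomorphic open_ball]])
        show "cmod (deriv h u) \<le> K / (2 * \<delta>\<^sup>2 * r n)" by (rule d[OF u])
      qed auto
      also have "\<dots> = K / (2 * \<delta>\<^sup>2) * e n"
        unfolding yz using r(1)[of n] by simp
      finally show ?case .
    qed
  qed
  have "(\<lambda>n. K / (2 * \<delta>\<^sup>2) * e n) \<longlonglongrightarrow> 0"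
    by (intro tendsto_mult_right_zero elim0)
  with ev have "(\<lambda>n. h (y n) - h (z n)) \<longlonglongrightarrow> 0" by (rule Lim_null_comparison)
  then have "(\<lambda>n. h (y n) - h (z n) - 1) \<longlonglongrightarrow> 0 - 1" by (intro tendsto_intros)
  moreover have "h (y n) - h (z n) - 1 = h (z (Suc n)) - h (z n)" for n
    using h_flow[of 1 "z (Suc n)"] z1[of "Suc n"] by (simp add: y_def)
  ultimately have "(\<lambda>n. h (z (Suc n)) - h (z n)) \<longlonglongrightarrow> - 1" by simp
  then show ?thesis using that[OF a(1)] by (simp add: z_def r_def del: power_Suc)
qed

end

text \<open>Along the radial points of \<open>koenigs_along_repelling_radius\<close> the factor by which \<open>|f|\<close> changes tends
  to \<open>exp (- Re \<mu>) > 1\<close>.\<close>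

lemma (in dirichlet_eigenfunction) no_repelling_fixed_point: "\<not> repelling_fixed_point \<phi> \<sigma>"
proof
  assume rep: "repelling_fixed_point \<phi> \<sigma>"
  then have \<sigma>: "cmod \<sigma> = 1" by (simp add: repelling_fixed_point_def)
  obtain a :: real where a: "1 < a" and lim:
    "(\<lambda>n. h (of_real (1 - (1/a) ^ Suc n) * \<sigma>) - h (of_real (1 - (1/a) ^ n) * \<sigma>)) \<longlonglongrightarrow> - 1"
    using koenigs_along_repelling_radius[OF rep] by blast
  define r where "r n = (1/a) ^ n" for n
  have r: "0 < r n" "r n \<le> 1" "r \<longlonglongrightarrow> 0" for n
    using a by (auto simp: r_def[abs_def] intro!: LIMSEQ_realpow_zero power_le_one)
  have rS: "r (Suc n) = r n / a" for n by (simp add: r_def)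
  define z where "z n = of_real (1 - r n) * \<sigma>" for n
  have zn: "cmod (z n) = 1 - r n" "cmod (\<sigma> - z n) = r n" for n
    using norm_radial[OF \<sigma>, of "r n"] r(1,2)[of n] by (simp_all only: z_def less_imp_le)
  have z1: "cmod (z n) < 1" for n using zn(1)[of n] r(1)[of n] by simp
  have zlim: "(\<lambda>n. cmod (z n)) \<longlonglongrightarrow> 1"
    unfolding zn(1) using tendsto_diff[OF tendsto_const[of 1] r(3)] by simp
  have zz: "cmod (z n - z (Suc n)) = r n - r n / a" for n
  proof -
    have "z n - z (Suc n) = of_real (r (Suc n) - r n) * \<sigma>" by (simp add: z_def algebra_simps)
    moreover have "r (Suc n) \<le> r n" using r(1)[of n] a by (simp add: rS divide_le_eq mult_left_le)
    moreover have "cmod (of_real (r (Suc n) - r n) * \<sigma>) = \<bar>r (Suc n) - r n\<bar>"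
      using \<sigma> by (simp only: norm_mult norm_of_real) simp
    ultimately show ?thesis by (simp add: rS)
  qed
  have "(\<lambda>n. f (z n) - f (z (Suc n))) \<longlonglongrightarrow> 0"
  proof (rule dirichlet_diff_tendsto_0[OF f_dirichlet _ _ zlim])
    fix n
    have ra: "r n \<le> a * r n" using a r(1)[of n] by simp
    have "0 < r n / a" using a r(1)[of n] by simp
    then show "cmod (z n - z (Suc n)) \<le> a * (1 - cmod (z n))" "cmod (z n - z (Suc n)) \<le> a * (1 - cmod (z (Suc n)))"
      using ra a unfolding zz zn(1) by (simp_all add: rS)
  qed (rule z1)+
  \<comment> \<open>Any growth factor strictly between \<open>1\<close> and \<open>exp (- Re \<mu>)\<close> serves; this is the midpoint.\<close>
  moreover have "\<forall>\<^sub>F n in sequentially. (1 + exp (- Re \<mu>)) / 2 * cmod (f (z n)) \<le> cmod (f (z (Suc n)))"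
  proof -
    have "(\<lambda>n. cmod (exp (\<mu> * (h (z (Suc n)) - h (z n))))) \<longlonglongrightarrow> cmod (exp (\<mu> * (- 1)))"
      using lim unfolding z_def r_def by (intro tendsto_intros)
    then have "\<forall>\<^sub>F n in sequentially. (1 + exp (- Re \<mu>)) / 2 < cmod (exp (\<mu> * (h (z (Suc n)) - h (z n))))"
    proof (rule order_tendstoD(1))
      have "1 < exp (- Re \<mu>)" using Re_mu_neg by simp
      moreover have "cmod (exp (\<mu> * (- 1))) = exp (- Re \<mu>)" by simp
      ultimately show "(1 + exp (- Re \<mu>)) / 2 < cmod (exp (\<mu> * (- 1)))" by argo
    qed
    then show ?thesis
    proof eventually_elim
      case (elim n)
      have "f (z (Suc n)) = exp (\<mu> * (h (z (Suc n)) - h (z n))) * f (z n)"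
        using f_form[OF z1] by (simp add: exp_diff algebra_simps)
      then show ?case
        using mult_right_mono[OF less_imp_le[OF elim], of "cmod (f (z n))"] by (simp only: norm_mult norm_ge_zero)
    qed
  qed
  ultimately show False
    using differences_of_geometric_growth[of "(1 + exp (- Re \<mu>)) / 2" "\<lambda>n. f (z n)"] Re_mu_neg f_nonzero[OF z1]
    by auto
qed

section \<open>Orbits of finite shift\<close>

lemma norm_tendsto_1_of_cayley_at_infinity:
  assumes \<tau>: "cmod \<tau> = 1" and z: "\<And>n. cmod (z n) < 1" and lim: "filterlim (\<lambda>n. cayley \<tau> (z n)) at_infinity F"
  shows "((\<lambda>n. cmod (z n)) \<longlongrightarrow> 1) F"
proof -
  have eq: "z n = \<tau> - 2 * \<tau> / (cayley \<tau> (z n) + 1)" for n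
  proof -
    have "cayley \<tau> (z n) + 1 = 2 * \<tau> / (\<tau> - z n)"
      using cayley_denom[OF \<tau> z[of n]] by (simp add: cayley_def field_simps)
    moreover have "\<tau> \<noteq> 0" using \<tau> by auto
    ultimately show ?thesis using cayley_denom[OF \<tau> z[of n]] by simp
  qed
  have "filterlim (\<lambda>n. cayley \<tau> (z n) + 1) at_infinity F"
    by (rule tendsto_add_filterlim_at_infinity'[OF lim tendsto_const])
  then have "((\<lambda>n. \<tau> - 2 * \<tau> / (cayley \<tau> (z n) + 1)) \<longlongrightarrow> \<tau> - 0) F"
    by (intro tendsto_diff tendsto_const tendsto_divide_0[OF tendsto_const])
  then have "(z \<longlongrightarrow> \<tau>) F" using eq by simp
  then show ?thesis using tendsto_norm \<tau> by fastforce
qed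

text \<open>Let \<open>\<kappa>\<close> be the infimum of \<open>Re q / Re C\<close> for \<open>C = cayley \<tau>\<close>. Then \<open>p = q - \<kappa> C\<close> still has nonnegative
  real part, and there are points \<open>w\<close> with \<open>Re (p w) \<le> \<epsilon> Re (C w)\<close>. Schwarz-Pick for \<open>p\<close> against such
  a \<open>w\<close> bounds \<open>|p|\<close> on the ray \<open>C z = s d\<close> by \<open>\<epsilon> s |d|\<^sup>2 / Re d + o(s)\<close>, hence \<open>p = o(s)\<close> there.\<close>

lemma Julia_Caratheodory:
  assumes \<tau>: "cmod \<tau> = 1" and hol: "q holomorphic_on unit_disk"
    and \<kappa>0: "0 < \<kappa>\<^sub>0" and lower: "\<forall>z\<in>unit_disk. \<kappa>\<^sub>0 * Re (cayley \<tau> z) \<le> Re (q z)"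
  shows "\<exists>\<kappa>>0. \<forall>z d s. (\<forall>n. cmod (z n) < 1 \<and> cayley \<tau> (z n) = of_real (s n) * d) \<longrightarrow> 0 < Re d \<longrightarrow>
      filterlim s at_top sequentially \<longrightarrow> (\<lambda>n::nat. q (z n) / of_real (s n)) \<longlonglongrightarrow> of_real (\<kappa>::real) * d"
proof -
  let ?C = "cayley \<tau>"
  define S where "S = (\<lambda>z. Re (q z) / Re (?C z)) ` unit_disk"
  define \<kappa> where "\<kappa> = Inf S"
  have C0: "0 < Re (?C z)" if "cmod z < 1" for z using Re_cayley_pos[OF \<tau> that] .
  have Slow: "\<kappa>\<^sub>0 \<le> x" if "x \<in> S" for x
    using that lower C0 by (auto simp: S_def pos_le_divide_eq)
  have bdd: "bdd_below S" using Slow by (rule bdd_belowI)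
  have Sne: "S \<noteq> {}" by (simp add: S_def)
  have \<kappa>: "\<kappa>\<^sub>0 \<le> \<kappa>" unfolding \<kappa>_def by (rule cInf_greatest[OF Sne Slow])
  define p where "p z = q z - of_real \<kappa> * ?C z" for z
  have phol: "p holomorphic_on unit_disk"
    unfolding p_def by (intro holomorphic_intros hol cayley_holomorphic \<tau>)
  have ppos: "0 \<le> Re (p z)" if z: "cmod z < 1" for z
  proof -
    have "\<kappa> \<le> Re (q z) / Re (?C z)"
      unfolding \<kappa>_def using z by (intro cInf_lower bdd) (auto simp: S_def)
    then show ?thesis using C0[OF z] by (simp add: p_def pos_le_divide_eq)
  qed
  have psmall: "\<exists>w. cmod w < 1 \<and> Re (p w) \<le> \<epsilon> * Re (?C w)" if "0 < \<epsilon>" for \<epsilon>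
  proof -
    obtain x where "x \<in> S" "x < \<kappa> + \<epsilon>"
      using cInf_lessD[OF Sne, of "\<kappa> + \<epsilon>"] \<open>0 < \<epsilon>\<close> by (auto simp: \<kappa>_def)
    then obtain w where w: "cmod w < 1" "Re (q w) / Re (?C w) < \<kappa> + \<epsilon>" by (auto simp: S_def)
    then have "Re (p w) \<le> \<epsilon> * Re (?C w)"
      using C0[OF w(1)] by (simp add: p_def pos_divide_less_eq algebra_simps)
    then show ?thesis using w(1) by blast
  qed
  show ?thesis
  proof (intro exI[of _ \<kappa>] conjI allI impI)
    show "0 < \<kappa>" using \<kappa> \<kappa>0 by simp
    fix z :: "nat \<Rightarrow> complex" and d :: complex and s :: "nat \<Rightarrow> real"
    assume zC: "\<forall>n. cmod (z n) < 1 \<and> ?C (z n) = of_real (s n) * d" and d: "0 < Re d"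
      and s: "filterlim s at_top sequentially"
    have z: "cmod (z n) < 1" and Cz: "?C (z n) = of_real (s n) * d" for n using zC by auto
    have s0: "0 < s n" for n
      using C0[OF z[of n]] d by (simp add: Cz zero_less_mult_iff)
    have inv: "(\<lambda>n. inverse (s n)) \<longlonglongrightarrow> 0" by (rule tendsto_inverse_0_at_top[OF s])
    have "(\<lambda>n. p (z n) / of_real (s n)) \<longlonglongrightarrow> 0"
    proof (rule tendstoI)
      fix e :: real assume e: "0 < e"
      have dn: "0 < cmod d" using d by auto
      \<comment> \<open>Chosen to make the limit \<open>\<epsilon> |d|\<^sup>2 / Re d\<close> of the bound equal to \<open>e / 2\<close>.\<close>
      define \<epsilon> where "\<epsilon> = e * Re d / (2 * (cmod d)\<^sup>2)"
      have "0 < \<epsilon>" using e d dn by (simp add: \<epsilon>_def)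
      then obtain w where w: "cmod w < 1" "Re (p w) \<le> \<epsilon> * Re (?C w)" using psmall by blast
      let ?b = "\<lambda>n. \<epsilon> * (cmod (d + of_real (inverse (s n)) * cnj (?C w)))\<^sup>2 / Re d + inverse (s n) * cmod (p w)"
      have "?b \<longlonglongrightarrow> \<epsilon> * (cmod (d + of_real 0 * cnj (?C w)))\<^sup>2 / Re d + 0 * cmod (p w)"
        using d by (intro tendsto_intros inv) auto
      also have "\<epsilon> * (cmod (d + of_real 0 * cnj (?C w)))\<^sup>2 / Re d + 0 * cmod (p w) = e / 2"
        using d dn by (simp add: \<epsilon>_def power2_eq_square)
      finally have "\<forall>\<^sub>F n in sequentially. ?b n < e"
        by (rule order_tendstoD(2)) (use e in simp)
      then show "\<forall>\<^sub>F n in sequentially. dist (p (z n) / of_real (s n)) 0 < e"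
      proof eventually_elim
        case (elim n)
        let ?X = "cmod (p (z n) + cnj (p w))" and ?T = "cmod (?C (z n) + cnj (?C w))"
        have T: "?T\<^sup>2 = 4 * (s n * Re d) * Re (?C w) * pick_ratio (z n) w"
          using cayley_pick_ratio[OF \<tau> z[of n] w(1)] by (simp add: Cz)
        have reX: "Re (p (z n)) \<le> ?X"
          using complex_Re_le_cmod[of "p (z n) + cnj (p w)"] ppos[OF w(1)] by simp
        have "?X\<^sup>2 \<le> 4 * Re (p (z n)) * Re (p w) * pick_ratio (z n) w"
          by (rule Schwarz_Pick_halfplane[OF phol ppos z w(1)])
        also have "\<dots> \<le> 4 * ?X * (\<epsilon> * Re (?C w)) * pick_ratio (z n) w"
          using pick_ratio_pos[OF z[of n] w(1)] ppos[OF w(1)] ppos[OF z[of n]] reX w(2)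
          by (intro mult_right_mono mult_mono) auto
        also have "\<dots> = ?X * (\<epsilon> * ?T\<^sup>2 / (s n * Re d))"
          unfolding T using s0[of n] d by simp
        finally have XX: "?X * ?X \<le> ?X * (\<epsilon> * ?T\<^sup>2 / (s n * Re d))" by (simp add: power2_eq_square)
        have X: "?X \<le> \<epsilon> * ?T\<^sup>2 / (s n * Re d)"
        proof (cases "?X = 0")
          case True
          then show ?thesis using \<open>0 < \<epsilon>\<close> s0[of n] d by simp
        next
          case False
          then have "0 < ?X" using norm_ge_zero[of "p (z n) + cnj (p w)"] by linarith
          then show ?thesis using XX by (simp only: mult_le_cancel_left_pos)
        qed
        have "?C (z n) + cnj (?C w) = of_real (s n) * (d + of_real (inverse (s n)) * cnj (?C w))"
          using s0[of n] by (simp add: Cz algebra_simps)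
        then have "?T = s n * cmod (d + of_real (inverse (s n)) * cnj (?C w))"
          using s0[of n] by (simp only: norm_mult norm_of_real abs_of_pos)
        then have "\<epsilon> * ?T\<^sup>2 / (s n * Re d) = s n * (\<epsilon> * (cmod (d + of_real (inverse (s n)) * cnj (?C w)))\<^sup>2 / Re d)"
          using s0[of n] by (simp only: power_mult_distrib power2_eq_square[of "s n"]) simp
        moreover have "cmod (p (z n)) \<le> ?X + cmod (p w)"
          using norm_triangle_ineq4[of "p (z n) + cnj (p w)" "cnj (p w)"] by simp
        ultimately have "cmod (p (z n)) \<le> s n * ?b n"
          using X s0[of n] by (simp only: distrib_left mult.assoc[symmetric] right_inverse[OF less_imp_neq[OF s0, symmetric]] mult_1)
        then have "cmod (p (z n)) / s n \<le> ?b n" using s0[of n] by (simp only: pos_divide_le_eq mult.commute)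
        then show ?case using elim s0[of n] by (simp add: norm_divide)
      qed
    qed
    then have "(\<lambda>n. p (z n) / of_real (s n) + of_real \<kappa> * d) \<longlonglongrightarrow> 0 + of_real \<kappa> * d"
      by (intro tendsto_intros)
    moreover have "p (z n) / of_real (s n) + of_real \<kappa> * d = q (z n) / of_real (s n)" for n
      using s0[of n] by (simp add: p_def Cz field_simps)
    ultimately show "(\<lambda>n. q (z n) / of_real (s n)) \<longlonglongrightarrow> of_real \<kappa> * d" by simp
  qed
qed

text \<open>Julia's lemma at infinity, with the orbit itself as the test sequence. Along the orbit \<open>Re C\<close>
  stays between positive constants (below by \<open>Re_cayley_flow\<close>, above by finite shift), so bounded hyperbolic
  steps are bounded Euclidean steps of \<open>C\<close> and \<open>|C|\<close> grows at most linearly, whereas \<open>|q|\<close> grows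
  linearly with constant real part. In the Schwarz-Pick inequality for \<open>q\<close> between \<open>z\<close> and the orbit
  points, division by \<open>n\<^sup>2\<close> and passage to the limit gives the bound.\<close>

lemma (in koenigs_semigroup) cayley_lower_bound_of_finite_shift:
  assumes hol: "q holomorphic_on unit_disk" and pos: "\<And>z. cmod z < 1 \<Longrightarrow> 0 < Re (q z)"
    and s: "s = 1 \<or> s = - 1"
    and qflow: "\<And>t z. \<lbrakk>0 \<le> t; cmod z < 1\<rbrakk> \<Longrightarrow> q (\<phi> t z) = q z + of_real s * \<i> * of_real t"
    and z0: "cmod z\<^sub>0 < 1" and R: "\<And>t. 0 \<le> t \<Longrightarrow> Re (cayley \<tau> (\<phi> t z\<^sub>0)) \<le> R"
  shows "\<exists>\<kappa>>0. \<forall>z\<in>unit_disk. \<kappa> * Re (cayley \<tau> z) \<le> Re (q z)"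
proof -
  let ?C = "cayley \<tau>" and ?z = "\<lambda>n. \<phi> (real n) z\<^sub>0"
  define M where "M = pick_ratio z\<^sub>0 (\<phi> 1 z\<^sub>0)"
  define L where "L = R + 2 * R * sqrt M"
  define b where "b = Re (?C z\<^sub>0)"
  have b: "0 < b" using Re_cayley_pos[OF norm_tau z0] by (simp add: b_def)
  have z1: "cmod (?z n) < 1" for n by (intro flow_in_disk z0) simp
  have Cb: "b \<le> Re (?C (?z n))" "Re (?C (?z n)) \<le> R" for n
    using Re_cayley_flow[OF _ z0, of "real n"] R[of "real n"] by (simp_all add: b_def)
  have R0: "0 < R" using b Cb[of 0] by linarith
  have M0: "0 < M" unfolding M_def using z0 flow_in_disk[of 1 z\<^sub>0] by (intro pick_ratio_pos) auto
  have L0: "0 < L" using R0 M0 by (simp add: L_def add_pos_pos)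
  have zS: "?z (Suc n) = \<phi> 1 (?z n)" for n
    using flow_add[of 1 "real n" z\<^sub>0] z0 by simp
  have ratio: "pick_ratio (?z n) (?z (Suc n)) \<le> M" for n
  proof (induction n)
    case 0
    then show ?case using z0 by (simp add: M_def flow_0)
  next
    case (Suc n)
    have "pick_ratio (\<phi> 1 (?z n)) (\<phi> 1 (?z (Suc n))) \<le> pick_ratio (?z n) (?z (Suc n))"
      by (intro Schwarz_Pick flow_holomorphic flow_image z1) auto
    then show ?case using Suc unfolding zS[of "Suc n"] zS[of n] by linarith
  qed
  have step: "cmod (?C (?z (Suc n)) - ?C (?z n)) \<le> L" for n
  proof -
    let ?u = "?C (?z n)" and ?v = "?C (?z (Suc n))"
    have "(cmod (?u + cnj ?v))\<^sup>2 = 4 * Re ?u * Re ?v * pick_ratio (?z n) (?z (Suc n))"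
      by (rule cayley_pick_ratio[OF norm_tau z1 z1])
    also have "\<dots> \<le> 4 * R * R * M"
      using Cb[of n] Cb[of "Suc n"] b R0 ratio[of n] pick_ratio_pos[OF z1[of n] z1[of "Suc n"]]
      by (intro mult_mono) auto
    also have "\<dots> = (2 * R * sqrt M)\<^sup>2"
      using M0 by (simp add: power_mult_distrib power2_eq_square)
    finally have "cmod (?u + cnj ?v) \<le> 2 * R * sqrt M"
      by (rule power2_le_imp_le) (use R0 M0 in auto)
    then have "\<bar>Im (?v - ?u)\<bar> \<le> 2 * R * sqrt M"
      using abs_Im_le_cmod[of "?u + cnj ?v"] by simp
    moreover have "\<bar>Re (?v - ?u)\<bar> \<le> R"
      using Cb[of n] Cb[of "Suc n"] b by (simp add: abs_le_iff)
    ultimately show ?thesis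
      using cmod_le[of "?v - ?u"] by (simp add: L_def)
  qed
  have lin: "cmod (?C (?z n)) \<le> cmod (?C z\<^sub>0) + real n * L" for n
  proof (induction n)
    case 0
    then show ?case using z0 by (simp add: flow_0)
  next
    case (Suc n)
    have "cmod (?C (?z (Suc n))) \<le> cmod (?C (?z n)) + cmod (?C (?z (Suc n)) - ?C (?z n))"
      by (metis norm_triangle_sub)
    then show ?case using Suc step[of n] by (simp add: algebra_simps)
  qed
  have q0: "0 < Re (q z\<^sub>0)" by (rule pos[OF z0])
  have Rq: "Re (q (?z n)) = Re (q z\<^sub>0)" for n
    using qflow[of "real n" z\<^sub>0] z0 by simp
  have main: "b / (Re (q z\<^sub>0) * L\<^sup>2) * Re (?C z) \<le> Re (q z)" if z: "cmod z < 1" for z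
  proof -
    let ?A = "\<lambda>n. cmod ((q z + cnj (q z\<^sub>0)) * of_real (inverse (real (Suc n))) - of_real s * \<i>)"
    let ?B = "\<lambda>n. (cmod (?C z) + cmod (?C z\<^sub>0)) * inverse (real (Suc n)) + L"
    have "(?A n)\<^sup>2 * (Re (?C z) * b) \<le> Re (q z) * Re (q z\<^sub>0) * (?B n)\<^sup>2" for n
    proof -
      let ?m = "Suc n"
      let ?X = "cmod (q z + cnj (q (?z ?m)))" and ?T = "cmod (?C z + cnj (?C (?z ?m)))" and ?k = "pick_ratio z (?z ?m)"
      have "q z + cnj (q (?z ?m)) = of_real (real ?m) * ((q z + cnj (q z\<^sub>0)) * of_real (inverse (real ?m)) - of_real s * \<i>)"
        using qflow[of "real ?m" z\<^sub>0] z0 by (simp add: field_simps del: of_nat_Suc)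
      then have X: "?X = real ?m * ?A n"
        by (simp only: norm_mult norm_of_real abs_of_nat)
      have "?T \<le> cmod (?C z) + cmod (?C (?z ?m))"
        using norm_triangle_ineq[of "?C z" "cnj (?C (?z ?m))"] by simp
      also have "\<dots> \<le> (cmod (?C z) + cmod (?C z\<^sub>0)) + real ?m * L" using lin[of ?m] by simp
      also have "\<dots> = real ?m * ?B n" by (simp add: field_simps del: of_nat_Suc)
      finally have T: "?T \<le> real ?m * ?B n" .
      have C0: "0 < Re (?C z)" by (rule Re_cayley_pos[OF norm_tau z])
      have "?X\<^sup>2 * (Re (?C z) * b) \<le> (4 * Re (q z) * Re (q z\<^sub>0) * ?k) * (Re (?C z) * Re (?C (?z ?m)))"
      proof (intro mult_mono)
        show "?X\<^sup>2 \<le> 4 * Re (q z) * Re (q z\<^sub>0) * ?k"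
          using Schwarz_Pick_halfplane[OF hol _ z z1[of ?m]] pos Rq[of ?m] by (simp add: less_imp_le)
      qed (use C0 b Cb[of ?m] pos[OF z] q0 pick_ratio_pos[OF z z1[of ?m]] in auto)
      also have "\<dots> = Re (q z) * Re (q z\<^sub>0) * ?T\<^sup>2"
        unfolding cayley_pick_ratio[OF norm_tau z z1] by (simp only: mult_ac)
      also have "\<dots> \<le> Re (q z) * Re (q z\<^sub>0) * (real ?m * ?B n)\<^sup>2"
        using T pos[OF z] q0 by (intro mult_left_mono power_mono) auto
      finally have "(real ?m)\<^sup>2 * ((?A n)\<^sup>2 * (Re (?C z) * b)) \<le> (real ?m)\<^sup>2 * (Re (q z) * Re (q z\<^sub>0) * (?B n)\<^sup>2)"
        unfolding X power_mult_distrib by (simp only: mult_ac)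
      then show ?thesis by (rule mult_left_le_imp_le) simp
    qed
    moreover have "(\<lambda>n. (?A n)\<^sup>2 * (Re (?C z) * b))
        \<longlonglongrightarrow> (cmod ((q z + cnj (q z\<^sub>0)) * of_real 0 - of_real s * \<i>))\<^sup>2 * (Re (?C z) * b)"
      by (intro tendsto_intros LIMSEQ_inverse_real_of_nat)
    moreover have "(\<lambda>n. Re (q z) * Re (q z\<^sub>0) * (?B n)\<^sup>2)
        \<longlonglongrightarrow> Re (q z) * Re (q z\<^sub>0) * ((cmod (?C z) + cmod (?C z\<^sub>0)) * 0 + L)\<^sup>2"
      by (intro tendsto_intros LIMSEQ_inverse_real_of_nat)
    ultimately have "(cmod ((q z + cnj (q z\<^sub>0)) * of_real 0 - of_real s * \<i>))\<^sup>2 * (Re (?C z) * b)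
        \<le> Re (q z) * Re (q z\<^sub>0) * ((cmod (?C z) + cmod (?C z\<^sub>0)) * 0 + L)\<^sup>2"
      by (intro LIMSEQ_le) auto
    moreover have "cmod ((q z + cnj (q z\<^sub>0)) * of_real 0 - of_real s * \<i>) = 1"
      using s by (auto simp: norm_mult)
    ultimately have "Re (?C z) * b \<le> Re (q z) * Re (q z\<^sub>0) * L\<^sup>2" by simp
    then show ?thesis using q0 L0 by (simp add: field_simps)
  qed
  show ?thesis
    by (rule exI[of _ "b / (Re (q z\<^sub>0) * L\<^sup>2)"]) (use main b q0 L0 in auto)
qed

text \<open>The sign \<open>s\<close> covers the upper and the lower half-plane, and \<open>q\<close> is \<open>h\<close> rotated into the right
  half-plane, so that \<open>\<mu> h = \<nu> q + const\<close> with \<open>Im \<nu> = s Re \<mu> \<noteq> 0\<close>. For the points with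
  \<open>cayley \<tau> (z n) = 2^n d\<close> one has \<open>Re (\<nu> q (z n)) \<sim> 2^n \<kappa> Re (\<nu> d)\<close>, and because \<open>Im \<nu> \<noteq> 0\<close> some \<open>d\<close> in the
  right half-plane has \<open>Re (\<nu> d) > 0\<close>. Doubling keeps the hyperbolic steps constant while \<open>|f|\<close> grows
  at least geometrically.\<close>

lemma (in dirichlet_eigenfunction) no_finite_shift_in_halfplane:
  assumes s: "s = 1 \<or> s = - 1" and half: "\<And>z. cmod z < 1 \<Longrightarrow> 0 < s * (Im (h z) - y)"
    and z0: "cmod z\<^sub>0 < 1" and R: "\<And>t. 0 \<le> t \<Longrightarrow> Re (cayley \<tau> (\<phi> t z\<^sub>0)) \<le> R"
  shows False
proof -
  define q where "q z = of_real s * (- \<i> * h z - of_real y)" for z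
  have qhol: "q holomorphic_on unit_disk"
    unfolding q_def by (intro holomorphic_intros h_holomorphic)
  have qpos: "0 < Re (q z)" if "cmod z < 1" for z
    using half[OF that] by (simp add: q_def)
  have qflow: "q (\<phi> t z) = q z + of_real (- s) * \<i> * of_real t" if "0 \<le> t" "cmod z < 1" for t z
    using h_flow[OF that] by (simp add: q_def algebra_simps)
  have "\<exists>\<kappa>>0. \<forall>z\<in>unit_disk. \<kappa> * Re (cayley \<tau> z) \<le> Re (q z)"
  proof (rule cayley_lower_bound_of_finite_shift[OF qhol])
    show "- s = 1 \<or> - s = - 1" using s by auto
  qed (fact qpos qflow z0 R)+
  then obtain \<kappa>\<^sub>0 where \<kappa>0: "0 < \<kappa>\<^sub>0" "\<forall>z\<in>unit_disk. \<kappa>\<^sub>0 * Re (cayley \<tau> z) \<le> Re (q z)"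
    by blast
  obtain \<kappa> where \<kappa>: "0 < \<kappa>" and lim:
    "\<forall>z d r. (\<forall>n. cmod (z n) < 1 \<and> cayley \<tau> (z n) = of_real (r n) * d) \<longrightarrow> 0 < Re d \<longrightarrow>
      filterlim r at_top sequentially \<longrightarrow> (\<lambda>n::nat. q (z n) / of_real (r n)) \<longlonglongrightarrow> of_real \<kappa> * d"
    using Julia_Caratheodory[OF norm_tau qhol \<kappa>0] by (elim exE conjE)
  define \<nu> where "\<nu> = \<i> * of_real s * \<mu>"
  have \<mu>h: "\<mu> * h z = \<nu> * q z + \<mu> * \<i> * of_real y" for z
  proof -
    have "of_real s * of_real s = (1::complex)" using s by auto
    then have "\<i> * of_real s * q z = \<i> * (- \<i> * h z - of_real y)"
      unfolding q_def by (simp add: mult.assoc[symmetric])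
    then have "h z = \<i> * of_real s * q z + \<i> * of_real y" by (simp add: algebra_simps)
    then show ?thesis by (subst \<open>h z = _\<close>) (simp add: \<nu>_def algebra_simps)
  qed
  have Im\<nu>: "Im \<nu> \<noteq> 0" using Re_mu_neg s by (auto simp: \<nu>_def)
  \<comment> \<open>The imaginary part contributes \<open>(Im \<nu>)\<^sup>2\<close> to \<open>Re (\<nu> d)\<close>; the real part is positive but so small that
    it cannot outweigh this.\<close>
  define d where "d = Complex ((Im \<nu>)\<^sup>2 / (2 * (1 + \<bar>Re \<nu>\<bar>))) (- Im \<nu>)"
  have d: "0 < Re d" using Im\<nu> by (simp add: d_def add_pos_nonneg)
  define \<beta> where "\<beta> = \<kappa> * Re (\<nu> * d)"
  have \<beta>: "0 < \<beta>"
  proof -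
    have "\<bar>Re \<nu>\<bar> * Re d = (Im \<nu>)\<^sup>2 * (\<bar>Re \<nu>\<bar> / (2 * (1 + \<bar>Re \<nu>\<bar>)))" by (simp add: d_def)
    also have "\<dots> < (Im \<nu>)\<^sup>2 * 1" using Im\<nu> by (intro mult_strict_left_mono) (auto simp: divide_less_eq)
    finally have "\<bar>Re \<nu>\<bar> * Re d < (Im \<nu>)\<^sup>2" by simp
    moreover have "- (\<bar>Re \<nu>\<bar> * Re d) \<le> Re \<nu> * Re d"
      using d mult_right_mono[of "- \<bar>Re \<nu>\<bar>" "Re \<nu>" "Re d"] by simp
    ultimately have "0 < Re (\<nu> * d)" by (simp add: d_def power2_eq_square)
    then show ?thesis using \<kappa> by (simp add: \<beta>_def)
  qed
  have Re_scale: "Re (of_real x * w) = x * Re w" for x w by simp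
  have "\<exists>z. cmod z < 1 \<and> cayley \<tau> z = of_real (2 ^ n) * d" for n :: nat
  proof -
    have "0 < Re (of_real (2 ^ n) * d)" unfolding Re_scale using d by simp
    then show ?thesis using cayley_surj[OF norm_tau] by metis
  qed
  then obtain z where z: "\<And>n. cmod (z n) < 1" and Cz: "\<And>n::nat. cayley \<tau> (z n) = of_real (2 ^ n) * d"
    by metis
  have pow: "filterlim (\<lambda>n::nat. 2 ^ n :: real) at_top sequentially"
    by real_asymp
  define a where "a n = Re (\<nu> * q (z n))" for n
  have "(\<lambda>n. q (z n) / of_real (2 ^ n)) \<longlonglongrightarrow> of_real \<kappa> * d"
    using lim[rule_format, of z "\<lambda>n. 2 ^ n" d] z Cz d pow by blast
  then have "(\<lambda>n. Re (\<nu> * (q (z n) / of_real (2 ^ n)))) \<longlonglongrightarrow> Re (\<nu> * (of_real \<kappa> * d))"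
    by (intro tendsto_intros)
  moreover have "Re (\<nu> * (q (z n) / of_real (2 ^ n))) = a n / 2 ^ n" for n
    unfolding a_def by (simp only: times_divide_eq_right Re_divide_of_real)
  moreover have "Re (\<nu> * (of_real \<kappa> * d)) = \<beta>" by (simp add: \<beta>_def algebra_simps)
  ultimately have alim: "(\<lambda>n. a n / 2 ^ n) \<longlonglongrightarrow> \<beta>" by simp
  have "(\<lambda>n. 2 * (a (Suc n) / 2 ^ Suc n) - a n / 2 ^ n) \<longlonglongrightarrow> 2 * \<beta> - \<beta>"
    by (intro tendsto_intros alim LIMSEQ_Suc[OF alim])
  then have "\<forall>\<^sub>F n in sequentially. \<beta> / 2 < 2 * (a (Suc n) / 2 ^ Suc n) - a n / 2 ^ n"
    using \<beta> by (intro order_tendstoD(1)) auto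
  then have "\<forall>\<^sub>F n in sequentially. (1 + \<beta> / 2) * cmod (f (z n)) \<le> cmod (f (z (Suc n)))"
  proof eventually_elim
    case (elim n)
    have "\<beta> / 2 * 1 \<le> \<beta> / 2 * 2 ^ n" using \<beta> by (intro mult_left_mono) auto
    also have "\<dots> \<le> a (Suc n) - a n"
      using mult_right_mono[OF less_imp_le[OF elim], of "2 ^ n"] by (simp add: left_diff_distrib)
    finally have "1 + \<beta> / 2 \<le> exp (a (Suc n) - a n)"
      using exp_ge_add_one_self[of "a (Suc n) - a n"] by linarith
    moreover have "f (z (Suc n)) = exp (\<nu> * q (z (Suc n)) - \<nu> * q (z n)) * f (z n)"
      using f_form[OF z] by (simp add: \<mu>h exp_add exp_diff)
    then have "cmod (f (z (Suc n))) = exp (a (Suc n) - a n) * cmod (f (z n))"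
      by (simp only: norm_mult norm_exp_eq_Re a_def minus_complex.sel)
    ultimately show ?case by (simp add: mult_right_mono)
  qed
  moreover have "(\<lambda>n. f (z n) - f (z (Suc n))) \<longlonglongrightarrow> 0"
  proof (rule dirichlet_pick_step[OF f_dirichlet z])
    show "(\<lambda>n. cmod (z n)) \<longlonglongrightarrow> 1"
    proof (rule norm_tendsto_1_of_cayley_at_infinity[OF norm_tau z])
      have "filterlim (\<lambda>n::nat. d * of_real (2 ^ n)) at_infinity sequentially"
        using d by (intro tendsto_mult_filterlim_at_infinity[OF tendsto_const] filterlim_compose[OF filterlim_of_real_at_infinity pow]) auto
      then show "filterlim (\<lambda>n. cayley \<tau> (z n)) at_infinity sequentially"
        by (simp only: Cz mult.commute)
    qed
    fix n
    have eq: "cayley \<tau> (z n) + cnj (cayley \<tau> (z (Suc n))) = of_real (2 ^ n) * (d + 2 * cnj d)"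
      by (simp add: Cz algebra_simps)
    have A: "(cmod (cayley \<tau> (z n) + cnj (cayley \<tau> (z (Suc n)))))\<^sup>2 = (2 ^ n)\<^sup>2 * (cmod (d + 2 * cnj d))\<^sup>2"
      unfolding eq norm_mult norm_of_real power_mult_distrib by simp
    have B: "4 * Re (cayley \<tau> (z n)) * Re (cayley \<tau> (z (Suc n))) = (2 ^ n)\<^sup>2 * (8 * (Re d)\<^sup>2)"
      unfolding Cz Re_scale by (simp add: power2_eq_square)
    have "(2 ^ n)\<^sup>2 * (cmod (d + 2 * cnj d))\<^sup>2 = (2 ^ n)\<^sup>2 * (8 * (Re d)\<^sup>2) * pick_ratio (z n) (z (Suc n))"
      using cayley_pick_ratio[OF norm_tau z[of n] z[of "Suc n"]] unfolding A B .
    then have "(cmod (d + 2 * cnj d))\<^sup>2 = 8 * (Re d)\<^sup>2 * pick_ratio (z n) (z (Suc n))" by simp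
    then show "pick_ratio (z n) (z (Suc n)) \<le> (cmod (d + 2 * cnj d))\<^sup>2 / (8 * (Re d)\<^sup>2)"
      using d by (simp add: field_simps)
  qed
  ultimately show False
    using differences_of_geometric_growth[of "1 + \<beta> / 2" "\<lambda>n. f (z n)"] \<beta> f_nonzero[OF z] by auto
qed

section \<open>The point spectrum\<close>

lemma zero_in_dirichlet_point_spectrum: "0 \<in> dirichlet_point_spectrum \<phi>"
proof -
  have const: "(\<lambda>z. a) \<in> dirichlet_space" for a
    by (simp add: dirichlet_space_def set_integrable_def)
  have "dirichlet_norm (\<lambda>z. 0) = 0"
    by (simp add: dirichlet_norm_def set_lebesgue_integral_def)
  then have "dirichlet_generator \<phi> (\<lambda>z. 1) (\<lambda>z. 0 * 1)"
    by (simp add: dirichlet_generator_def dirichlet_tendsto_def composition_operator_def o_def const)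
  then show ?thesis
    unfolding dirichlet_point_spectrum_def by (intro CollectI exI[of _ "\<lambda>z. 1"]) (auto intro: exI[of _ 0])
qed

text \<open>The horodisk of radius \<open>r\<close> is the set of points of the disk where \<open>Re (cayley \<tau> z) > (1 - r) / r\<close>.\<close>

lemma Re_cayley_outside_horodisk:
  assumes \<tau>: "cmod \<tau> = 1" and z: "cmod z < 1" and r: "0 < r" "z \<notin> horodisk \<tau> r"
  shows "Re (cayley \<tau> z) \<le> (1 - r) / r"
proof -
  have tz: "0 < (cmod (\<tau> - z))\<^sup>2" using cayley_denom[OF \<tau> z] by simp
  have t1: "(Re \<tau>)\<^sup>2 + (Im \<tau>)\<^sup>2 = 1" using \<tau> by (simp flip: cmod_power2)
  have "r \<le> cmod (of_real (1 - r) * \<tau> - z)"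
    using r(2) by (simp add: horodisk_def dist_norm not_less)
  then have "r\<^sup>2 \<le> (cmod (of_real (1 - r) * \<tau> - z))\<^sup>2"
    using r(1) by (intro power_mono) auto
  also have "\<dots> = (1 - r)\<^sup>2 * ((Re \<tau>)\<^sup>2 + (Im \<tau>)\<^sup>2) - 2 * (1 - r) * (Re \<tau> * Re z + Im \<tau> * Im z) + (cmod z)\<^sup>2"
    unfolding cmod_power2 by (simp add: power2_eq_square algebra_simps)
  finally have h: "r\<^sup>2 \<le> (1 - r)\<^sup>2 - 2 * (1 - r) * (Re \<tau> * Re z + Im \<tau> * Im z) + (cmod z)\<^sup>2"
    by (simp add: t1)
  have "(cmod (\<tau> - z))\<^sup>2 = ((Re \<tau>)\<^sup>2 + (Im \<tau>)\<^sup>2) - 2 * (Re \<tau> * Re z + Im \<tau> * Im z) + (cmod z)\<^sup>2"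
    unfolding cmod_power2 by (simp add: power2_eq_square algebra_simps)
  then have e: "(cmod (\<tau> - z))\<^sup>2 = 1 - 2 * (Re \<tau> * Re z + Im \<tau> * Im z) + (cmod z)\<^sup>2"
    by (simp only: t1)
  have "(1 - r) * (cmod (\<tau> - z))\<^sup>2 - r * (1 - (cmod z)\<^sup>2)
      = (1 - r)\<^sup>2 - 2 * (1 - r) * (Re \<tau> * Re z + Im \<tau> * Im z) + (cmod z)\<^sup>2 - r\<^sup>2"
    unfolding e by (simp add: power2_eq_square[of r] power2_eq_square[of "1 - r"] algebra_simps)
  then have "r * (1 - (cmod z)\<^sup>2) \<le> (1 - r) * (cmod (\<tau> - z))\<^sup>2" using h by linarith
  then show ?thesis
    using tz r(1) by (simp add: Re_cayley[OF \<tau>] divide_le_eq le_divide_eq mult_ac)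
qed

lemma dirichlet_point_spectrum_eigenfunction:
  assumes "holomorphic_semigroup \<phi>" "koenigs_function \<phi> h" "denjoy_wolff_point \<phi> \<tau>"
    and \<mu>: "\<mu> \<in> dirichlet_point_spectrum \<phi>" "\<mu> \<noteq> 0"
  shows "\<exists>f c. dirichlet_eigenfunction \<phi> h \<tau> f \<mu> c"
proof -
  interpret koenigs_semigroup \<phi> h \<tau> using assms by unfold_locales
  obtain f z where f: "cmod z < 1" "f z \<noteq> 0" "dirichlet_generator \<phi> f (\<lambda>z. \<mu> * f z)"
    using \<mu>(1) by (auto simp: dirichlet_point_spectrum_def)
  obtain c where c: "\<And>z. cmod z < 1 \<Longrightarrow> f z = c * exp (\<mu> * h z)"
    using eigenfunction_form[OF f(3)] by blast
  have "dirichlet_eigenfunction \<phi> h \<tau> f \<mu> c"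
  proof
    show "c \<noteq> 0" using c[OF f(1)] f(2) by auto
    show "f \<in> dirichlet_space" using f(3) by (simp add: dirichlet_generator_def)
  qed (use c \<mu>(2) in auto)
  then show ?thesis by blast
qed

theorem corollary3p13:
  fixes \<phi> :: "real \<Rightarrow> complex \<Rightarrow> complex"
  assumes "parabolic_semigroup \<phi>"
    and "positive_hyperbolic_step \<phi>"
  shows "(is_group \<phi> \<longrightarrow> dirichlet_point_spectrum \<phi> = {0}) \<and>
    ((\<exists>\<sigma>. repelling_fixed_point \<phi> \<sigma>) \<longrightarrow> dirichlet_point_spectrum \<phi> = {0}) \<and>
    (finite_shift \<phi> \<longrightarrow> dirichlet_point_spectrum \<phi> = {0})"
proof -
  have sg: "holomorphic_semigroup \<phi>"
    using assms(1) by (simp add: parabolic_semigroup_def non_elliptic_semigroup_def)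
  obtain \<tau> where \<tau>: "denjoy_wolff_point \<phi> \<tau>"
    using assms(1) by (auto simp: parabolic_semigroup_def)
  obtain h y where h: "koenigs_function \<phi> h"
    and half: "h ` unit_disk \<subseteq> {w. Im w > y} \<or> h ` unit_disk \<subseteq> {w. Im w < y}"
    using assms(2) by (auto simp: positive_hyperbolic_step_def)
  have spectrum: "dirichlet_point_spectrum \<phi> = {0}"
    if "denjoy_wolff_point \<phi> \<tau>'" "\<And>f \<mu> c. \<not> dirichlet_eigenfunction \<phi> h \<tau>' f \<mu> c" for \<tau>'
    using that dirichlet_point_spectrum_eigenfunction[OF sg h that(1)] zero_in_dirichlet_point_spectrum by blast
  show ?thesis
  proof (intro conjI impI)
    assume "is_group \<phi>"
    then have "disk_automorphism (\<phi> 1)" by (simp add: is_group_def)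
    then show "dirichlet_point_spectrum \<phi> = {0}"
      using dirichlet_eigenfunction.flow_not_automorphism by (intro spectrum[OF \<tau>]) blast
  next
    assume "\<exists>\<sigma>. repelling_fixed_point \<phi> \<sigma>"
    then show "dirichlet_point_spectrum \<phi> = {0}"
      using dirichlet_eigenfunction.no_repelling_fixed_point by (intro spectrum[OF \<tau>]) blast
  next
    assume "finite_shift \<phi>"
    then obtain \<tau>' z r where \<tau>': "denjoy_wolff_point \<phi> \<tau>'" and "z \<in> unit_disk" and r: "0 < r"
      and avoid: "{\<phi> t z |t. t \<ge> 0} \<inter> horodisk \<tau>' r = {}"
      unfolding finite_shift_def by blast
    then have z: "cmod z < 1" by simp
    show "dirichlet_point_spectrum \<phi> = {0}"
    proof (rule spectrum[OF \<tau>'], rule notI)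
      fix f \<mu> c assume "dirichlet_eigenfunction \<phi> h \<tau>' f \<mu> c"
      then interpret dirichlet_eigenfunction \<phi> h \<tau>' f \<mu> c .
      have R: "Re (cayley \<tau>' (\<phi> t z)) \<le> (1 - r) / r" if t: "0 \<le> t" for t
      proof (rule Re_cayley_outside_horodisk[OF norm_tau flow_in_disk[OF t z] r])
        show "\<phi> t z \<notin> horodisk \<tau>' r" using avoid t by blast
      qed
      from half show False
      proof
        assume "h ` unit_disk \<subseteq> {w. Im w > y}"
        then show False
          by (intro no_finite_shift_in_halfplane[of 1 y, OF _ _ z R]) (auto simp: image_subset_iff)
      next
        assume "h ` unit_disk \<subseteq> {w. Im w < y}"
        then show False
          by (intro no_finite_shift_in_halfplane[of "- 1" y, OF _ _ z R]) (auto simp: image_subset_iff)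
      qed
    qed
  qed
qed

end
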